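(* For any $\boldsymbol\alpha=(\alpha_0,\alpha_1,\alpha_2,\alpha_3)\in[-1,+\infty)^4$ and $\boldsymbol\ell=(\ell_1,\ell_2,\ell_3)\in\mathbb{N}_0^3$, the following relations hold for the generalized Koornwinder polynomials on $\hat{\mathcal T}$: \begin{align*} \partial_{\hat x_1}\mathcal J_{\boldsymbol\ell}^{\boldsymbol\alpha}(\hat{\boldsymbol x})&=2d_{\ell_1}^{\alpha_0,\alpha_1}\mathcal J_{\boldsymbol\ell-(1,0,0)}^{\boldsymbol\alpha+(1,1,0,0)}(\hat{\boldsymbol x}),\\ \partial_{\hat x_2}\mathcal J_{\boldsymbol\ell}^{\boldsymbol\alpha}(\hat{\boldsymbol x})&=\sum_{p=0}^1\mathcal D^2_p(\boldsymbol\ell,\boldsymbol\alpha)\,\mathcal J_{\boldsymbol\ell-(p,1-p,0)}^{\boldsymbol\alpha+(1,0,1,0)}(\hat{\boldsymbol x}),\\ (\partial_{\hat x_2}-\partial_{\hat x_1})\mathcal J_{\boldsymbol\ell}^{\boldsymbol\alpha}(\hat{\boldsymbol x})&=\sum_{p=0}^1\mathcal D^{21}_p(\boldsymbol\ell,\boldsymbol\alpha)\,\mathcal J_{\boldsymbol\ell-(p,1-p,0)}^{\boldsymbol\alpha+(0,1,1,0)}(\hat{\boldsymbol x}),\\ \partial_{\hat x_3}\mathcal J_{\boldsymbol\ell}^{\boldsymbol\alpha}(\hat{\boldsymbol x})&=\sum_{p=0}^1\sum_{q=0}^1\mathcal D^3_{p,q}(\boldsymbol\ell,\boldsymbol\alpha)\,\mathcal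 J_{\boldsymbol\ell-(p,\,q-p,\,1-q)}^{\boldsymbol\alpha+(1,0,0,1)}(\hat{\boldsymbol x}),\\ (\partial_{\hat x_1}-\partial_{\hat x_3})\mathcal J_{\boldsymbol\ell}^{\boldsymbol\alpha}(\hat{\boldsymbol x})&=\sum_{p=0}^1\sum_{q=0}^1\mathcal D^{13}_{p,q}(\boldsymbol\ell,\boldsymbol\alpha)\,\mathcal J_{\boldsymbol\ell-(p,\,q-p,\,1-q)}^{\boldsymbol\alpha+(0,1,0,1)}(\hat{\boldsymbol x}),\\ (\partial_{\hat x_3}-\partial_{\hat x_2})\mathcal J_{\boldsymbol\ell}^{\boldsymbol\alpha}(\hat{\boldsymbol x})&=\sum_{q=0}^1\mathcal D^{32}_q(\boldsymbol\ell,\boldsymbol\alpha)\,\mathcal J_{\boldsymbol\ell-(0,q,1-q)}^{\boldsymbol\alpha+(0,0,1,1)}(\hat{\boldsymbol x}). \end{align*} Here, with $A:=2\ell_1+\alpha_0+\alpha_1+1$, $B:=2\ell_1+2\ell_2+\alpha_0+\alpha_1+\alpha_2+2$ and $$\rho:=2d_{\ell_1}^{\alpha_0,\alpha_1}e_{1,\ell_1-1}^{\alpha_1,\alpha_0+1}-\ell_1b_{2,\ell_1}^{\alpha_0,\alpha_1},\quad \kappa:=\ell_1b_{2,\ell_1}^{\alpha_1,\alpha_0}-2d_{\ell_1}^{\alpha_0,\alpha_1}e_{1,\ell_1-1}^{\alpha_0,\alpha_1+1},\quad \theta:=2d_{\ell_2}^{A,\alpha_2}e_{1,\ell_2-1}^{\alpha_2,A+1}-\ell_2b_{2,\ell_2}^{A,\alpha_2},$$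 the coefficients are \begin{align*} \mathcal D^2_0&=2d_{\ell_2}^{A,\alpha_2}b_{1,\ell_1}^{\alpha_0,\alpha_1},\qquad \mathcal D^2_1=\frac{\rho\,b_{1,\ell_2}^{A,\alpha_2}+2d_{\ell_2}^{A,\alpha_2}b_{2,\ell_1}^{\alpha_0,\alpha_1}e_{2,\ell_2-1}^{A,\alpha_2+1}}{b_{1,\ell_2}^{A-1,\alpha_2+1}},\\ \mathcal D^{21}_0&=\mathcal D^2_0,\qquad \mathcal D^{21}_1=\frac{\kappa\,b_{1,\ell_2}^{A,\alpha_2}-2d_{\ell_2}^{A,\alpha_2}b_{2,\ell_1}^{\alpha_1,\alpha_0}e_{2,\ell_2-1}^{A,\alpha_2+1}}{b_{1,\ell_2}^{A-1,\alpha_2+1}},\\ \mathcal D^3_{0,0}&=2d_{\ell_3}^{B,\alpha_3}b_{1,\ell_1}^{\alpha_0,\alpha_1}b_{1,\ell_2}^{A,\alpha_2},\qquad \mathcal D^3_{0,1}=\frac{b_{1,\ell_1}^{\alpha_0,\alpha_1}\theta\,b_{1,\ell_3}^{B,\alpha_3}+2d_{\ell_3}^{B,\alpha_3}b_{1,\ell_1}^{\alpha_0,\alpha_1}b_{2,\ell_2}^{A,\alpha_2}e_{2,\ell_3-1}^{B,\alpha_3+1}}{b_{1,\ell_3}^{B-1,\alpha_3+1}},\\ \mathcal D^3_{1,0}&=2d_{\ell_3}^{B,\alpha_3}b_{2,\ell_1}^{\alpha_0,\alpha_1}e_{2,\ell_2}^{A-1,\alpha_2},\\ \mathcal D^3_{1,1}&=\frac{\big(\rho+b_{2,\ell_1}^{\alpha_0,\alpha_1}e_{2,\ell_2-1}^{A,\alpha_2}\theta\big)b_{1,\ell_3}^{B,\alpha_3}+2b_{1,\ell_2}^{A-1,\alpha_2}d_{\ell_3}^{B,\alpha_3}b_{2,\ell_1}^{\alpha_0,\alpha_1}e_{1,\ell_2}^{A-1,\alpha_2}e_{2,\ell_3-1}^{B,\alpha_3+1}}{b_{1,\ell_2}^{A-1,\alpha_2}b_{1,\ell_3}^{B-1,\alpha_3+1}},\\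 \mathcal D^{13}_{0,0}&=-\mathcal D^3_{0,0},\qquad \mathcal D^{13}_{0,1}=-\mathcal D^3_{0,1},\qquad \mathcal D^{13}_{1,0}=2d_{\ell_3}^{B,\alpha_3}b_{2,\ell_1}^{\alpha_1,\alpha_0}e_{2,\ell_2}^{A-1,\alpha_2},\\ \mathcal D^{13}_{1,1}&=\frac{\big(b_{2,\ell_1}^{\alpha_1,\alpha_0}e_{2,\ell_2-1}^{A,\alpha_2}\theta-\kappa\big)b_{1,\ell_3}^{B,\alpha_3}+2b_{1,\ell_2}^{A-1,\alpha_2}d_{\ell_3}^{B,\alpha_3}b_{2,\ell_1}^{\alpha_1,\alpha_0}e_{1,\ell_2}^{A-1,\alpha_2}e_{2,\ell_3-1}^{B,\alpha_3+1}}{b_{1,\ell_2}^{A-1,\alpha_2}b_{1,\ell_3}^{B-1,\alpha_3+1}},\\ \mathcal D^{32}_0&=2d_{\ell_3}^{B,\alpha_3}b_{1,\ell_2}^{A,\alpha_2},\\ \mathcal D^{32}_1&=\frac{\big(\ell_2b_{2,\ell_2}^{\alpha_2,A}-2d_{\ell_2}^{A,\alpha_2}e_{1,\ell_2-1}^{A,\alpha_2+1}\big)b_{1,\ell_3}^{B,\alpha_3}-2d_{\ell_3}^{B,\alpha_3}b_{2,\ell_2}^{\alpha_2,A}e_{2,\ell_3-1}^{B,\alpha_3+1}}{b_{1,\ell_3}^{B-1,\alpha_3+1}}. \end{align*}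
   Context: $\mathbb{N}_0=\{0,1,2,\dots\}$. Reference tetrahedron: $\hat{\mathcal T}=\{(\hat x_1,\hat x_2,\hat x_3)^{\mathsf T}: 0\le\hat x_1,\hat x_2,\hat x_3,\ \hat x_1+\hat x_2+\hat x_3\le1\}$. Generalized Jacobi polynomials. For $\alpha,\beta\ge-1$ and $k\in\mathbb{N}_0$, $$J_k^{\alpha,\beta}(z)=\sum_{j=0}^k\frac{(\alpha+j+1)_{k-j}(k+\alpha+\beta+1)_j}{j!(k-j)!}\Big(\frac{z-1}{2}\Big)^j,\quad (a)_n=a(a+1)\cdots(a+n-1),$$ except that $J_1^{-1,-1}(z):=z$. (In particular $J_0^{-1,-1}=1$ and $J_k^{-1,-1}=\frac{z-1}{2}\frac{z+1}{2}J_{k-2}^{1,1}$ for $k\ge2$.) Convention: $J_k^{\alpha,\beta}\equiv0$ for $k<0$. Generalized Koornwinder polynomials. For $\boldsymbol\alpha\in[-1,\infty)^4$, $\boldsymbol\ell\in\mathbb{N}_0^3$, $$\mathcal J_{\boldsymbol\ell}^{\boldsymbol\alpha}(\hat{\boldsymbol x})=(1-\hat x_2-\hat x_3)^{\ell_1}J_{\ell_1}^{\alpha_0,\alpha_1}\Big(\tfrac{2\hat x_1}{1-\hat x_2-\hat x_3}-1\Big)(1-\hat x_3)^{\ell_2}J_{\ell_2}^{2\ell_1+\alpha_0+\alpha_1+1,\alpha_2}\Big(\tfrac{2\hat x_2}{1-\hat x_3}-1\Big)J_{\ell_3}^{2\ell_1+2\ell_2+\alpha_0+\alpha_1+\alpha_2+2,\alpha_3}(2\hat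 x_3-1),$$ which is a polynomial in $\hat{\boldsymbol x}$. Any term containing $\mathcal J_{\boldsymbol k}^{\boldsymbol\alpha}$ with some negative index $k_i<0$ is zero (whether or not its coefficient is defined). One-dimensional coefficients, for $k\in\mathbb{N}_0$: - $(b_{1,k}^{\alpha,\beta},b_{2,k}^{\alpha,\beta})$ equals $(1,0)$ if $k=0$; $(2,-1)$ if $k=1,\alpha=\beta=-1$; otherwise $\big(\frac{k+\alpha+\beta+1}{2k+\alpha+\beta+1},-\frac{k+\beta}{2k+\alpha+\beta+1}\big)$. - $(e_{1,k}^{\alpha,\beta},e_{2,k}^{\alpha,\beta})$ equals $(\frac12,-\frac12)$ if $k=0,\alpha=\beta=-1$; $(0,-1)$ if $k=1,\alpha=\beta=-1$; otherwise $\big(\frac{k+\alpha+1}{2k+\alpha+\beta+2},-\frac{k+1}{2k+\alpha+\beta+2}\big)$. - $d_k^{\alpha,\beta}=1$ if $k=1,\alpha=\beta=-1$; otherwise $d_k^{\alpha,\beta}=\frac{k+\alpha+\beta+1}{2}$. Conventions: $b_{i,k}^{\alpha,\beta}=e_{i,k}^{\alpha,\beta}=0$ for $k<0$, $i=1,2$. *)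

theory Defs
  imports "HOL-Analysis.Analysis" "HOL-Computational_Algebra.Polynomial"
begin

definition ref_tetrahedron :: "(real ^ 3) set" where
  "ref_tetrahedron = {x. 0 \<le> x $ 1 \<and> 0 \<le> x $ 2 \<and> 0 \<le> x $ 3 \<and> x $ 1 + x $ 2 + x $ 3 \<le> 1}"

definition partial_deriv :: "3 \<Rightarrow> (real ^ 3 \<Rightarrow> real) \<Rightarrow> real ^ 3 \<Rightarrow> real" where
  "partial_deriv i f x = deriv (\<lambda>t. f (x + t *\<^sub>R axis i 1)) 0"

text \<open>
  Generalized Jacobi polynomial of integer index, zero for negative index. The polynomial
  \<open>[:-1/2, 1/2:]\<close> is \<open>(z - 1) / 2\<close>.
\<close>

definition gjacobi :: "real \<Rightarrow> real \<Rightarrow> int \<Rightarrow> real poly" where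
  "gjacobi \<alpha> \<beta> k =
    (if k < 0 then 0
     else if k = 1 \<and> \<alpha> = -1 \<and> \<beta> = -1 then [:0, 1:]
     else (\<Sum>j\<le>nat k.
       smult (pochhammer (\<alpha> + real j + 1) (nat k - j) * pochhammer (of_int k + \<alpha> + \<beta> + 1) j
              / (fact j * fact (nat k - j)))
             ([:-1/2, 1/2:] ^ j)))"

text \<open>
  For \<open>degree p \<le> n\<close>, \<open>homog n p u s\<close> is the polynomial in \<open>u\<close> and \<open>s\<close> that equals
  \<open>s ^ n * poly p (u / s)\<close> wherever \<open>s \<noteq> 0\<close>.
\<close>

definition homog :: "nat \<Rightarrow> real poly \<Rightarrow> real \<Rightarrow> real \<Rightarrow> real" where
  "homog n p u s = (\<Sum>j\<le>n. coeff p j * u ^ j * s ^ (n - j))"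

text \<open>
  The generalized Koornwinder polynomial, zero as soon as some index is negative. The defining
  quotients are singular where \<open>1 - x $ 2 - x $ 3 = 0\<close> or \<open>1 - x $ 3 = 0\<close>, whereas the product is
  a polynomial; it is therefore written with the homogenizations, using
  \<open>2 * x $ 1 / s - 1 = (2 * x $ 1 - s) / s\<close> and likewise for the second factor.
  The quotient form is \<open>koornwinder_quotient_form\<close> below.
\<close>

fun koornwinder :: "real \<times> real \<times> real \<times> real \<Rightarrow> int \<times> int \<times> int \<Rightarrow> real ^ 3 \<Rightarrow> real" where
  "koornwinder (\<alpha>0, \<alpha>1, \<alpha>2, \<alpha>3) (l1, l2, l3) x =
    (if l1 < 0 \<or> l2 < 0 \<or> l3 < 0 then 0
     else
       (let s = 1 - x $ 2 - x $ 3; t = 1 - x $ 3 in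
         homog (nat l1) (gjacobi \<alpha>0 \<alpha>1 l1) (2 * x $ 1 - s) s *
         homog (nat l2) (gjacobi (2 * of_int l1 + \<alpha>0 + \<alpha>1 + 1) \<alpha>2 l2) (2 * x $ 2 - t) t *
         poly (gjacobi (2 * of_int l1 + 2 * of_int l2 + \<alpha>0 + \<alpha>1 + \<alpha>2 + 2) \<alpha>3 l3) (2 * x $ 3 - 1)))"

lemma poly_gjacobi:
  assumes "\<not> (k = 1 \<and> \<alpha> = -1 \<and> \<beta> = -1)"
  shows "poly (gjacobi \<alpha> \<beta> (int k)) z =
    (\<Sum>j=0..k. pochhammer (\<alpha> + real j + 1) (k - j) * pochhammer (real k + \<alpha> + \<beta> + 1) j
       / (fact j * fact (k - j)) * ((z - 1) / 2) ^ j)"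
proof -
  have w: "poly [:- (1/2), 1/2:] z = (z - 1) / 2" by (simp add: field_simps)
  show ?thesis
    using assms by (auto simp: gjacobi_def poly_sum poly_power w atMost_atLeast0 simp del: poly_pCons)
qed

lemma degree_gjacobi: "degree (gjacobi \<alpha> \<beta> k) \<le> nat k"
proof -
  have "degree ([:- (1/2), 1/2::real:] ^ j) \<le> n" if "j \<le> n" for j n
    using degree_power_le[of "[:- (1/2), 1/2::real:]" j] that by simp
  then show ?thesis
    by (auto simp: gjacobi_def intro!: degree_sum_le order_trans[OF degree_smult_le])
qed

lemma homog_quotient_form:
  assumes "degree p \<le> n" "s \<noteq> 0"
  shows "homog n p u s = s ^ n * poly p (u / s)"
proof -
  have "poly p (u / s) = (\<Sum>j\<le>n. coeff p j * (u / s) ^ j)"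
    unfolding poly_altdef using assms(1)
    by (intro sum.mono_neutral_left) (auto simp: coeff_eq_0)
  moreover have "coeff p j * u ^ j * s ^ (n - j) = s ^ n * (coeff p j * (u / s) ^ j)" if "j \<le> n" for j
    using assms(2) that by (simp add: power_divide power_diff field_simps)
  then have "homog n p u s = (\<Sum>j\<le>n. s ^ n * (coeff p j * (u / s) ^ j))"
    unfolding homog_def by (intro sum.cong) (use atMost_iff in blast)+
  ultimately show ?thesis
    by (simp only: sum_distrib_left)
qed

lemma koornwinder_quotient_form:
  assumes "1 - x $ 2 - x $ 3 \<noteq> 0" "1 - x $ 3 \<noteq> 0"
  shows "koornwinder (\<alpha>0, \<alpha>1, \<alpha>2, \<alpha>3) (int l1, int l2, int l3) x =
    (1 - x $ 2 - x $ 3) ^ l1 *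
      poly (gjacobi \<alpha>0 \<alpha>1 (int l1)) (2 * x $ 1 / (1 - x $ 2 - x $ 3) - 1) *
    (1 - x $ 3) ^ l2 *
      poly (gjacobi (2 * real l1 + \<alpha>0 + \<alpha>1 + 1) \<alpha>2 (int l2)) (2 * x $ 2 / (1 - x $ 3) - 1) *
    poly (gjacobi (2 * real l1 + 2 * real l2 + \<alpha>0 + \<alpha>1 + \<alpha>2 + 2) \<alpha>3 (int l3)) (2 * x $ 3 - 1)"
proof -
  have h: "homog n (gjacobi a b (int n)) (2 * y - s) s
      = s ^ n * poly (gjacobi a b (int n)) (2 * y / s - 1)" if "s \<noteq> 0" for n a b and y s :: real
    using homog_quotient_form[OF _ that] degree_gjacobi[of a b "int n"] that
    by (simp add: diff_divide_distrib)
  show ?thesis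
    using h[OF assms(1)] h[OF assms(2)] by (simp add: Let_def)
qed

lemma koornwinder_differentiable: "koornwinder \<alpha> l differentiable (at x)"
proof -
  have P: "(\<lambda>x::real^3. poly p (f x)) differentiable (at x)" if "f differentiable (at x)"
    for p :: "real poly" and f
    by (induction p) (use that in \<open>auto intro!: derivative_intros\<close>)
  have H: "(\<lambda>x::real^3. homog n p (f x) (g x)) differentiable (at x)"
    if "f differentiable (at x)" "g differentiable (at x)" for n p f g
    unfolding homog_def using that by (intro differentiable_sum ballI) (auto intro!: derivative_intros)
  obtain \<alpha>0 \<alpha>1 \<alpha>2 \<alpha>3 l1 l2 l3 where e: "\<alpha> = (\<alpha>0, \<alpha>1, \<alpha>2, \<alpha>3)" "l = (l1, l2, l3)"
    by (metis prod.collapse)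
  have N: "(\<lambda>x::real^3. x $ i) differentiable (at x)" for i
    by (rule bounded_linear_imp_differentiable[OF bounded_linear_vec_nth])
  have "(\<lambda>x. koornwinder \<alpha> l x) differentiable (at x)"
    by (cases "l1 < 0 \<or> l2 < 0 \<or> l3 < 0") (auto simp: e Let_def intro!: derivative_intros P H N)
  then show ?thesis by simp
qed

lemma partial_deriv_eq_frechet_derivative:
  assumes "f differentiable (at x)"
  shows "partial_deriv i f x = frechet_derivative f (at x) (axis i 1)"
proof -
  define f' where "f' = frechet_derivative f (at x)"
  have "(f has_derivative f') (at (x + 0 *\<^sub>R axis i 1))"
    using assms by (simp add: f'_def frechet_derivative_works)
  moreover have "((\<lambda>t. x + t *\<^sub>R axis i 1) has_derivative (\<lambda>t. t *\<^sub>R axis i 1)) (at (0::real))"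
    by (auto intro!: derivative_eq_intros)
  ultimately have "((\<lambda>t. f (x + t *\<^sub>R axis i 1)) has_derivative (\<lambda>t. f' (t *\<^sub>R axis i 1))) (at (0::real))"
    by (rule has_derivative_compose[rotated])
  moreover have "f' (t *\<^sub>R axis i 1) = f' (axis i 1) * t" for t
    using assms by (simp add: f'_def linear_cmul linear_frechet_derivative)
  ultimately have "((\<lambda>t. f (x + t *\<^sub>R axis i 1)) has_field_derivative f' (axis i 1)) (at (0::real))"
    by (simp add: has_field_derivative_def)
  then show ?thesis
    by (simp add: partial_deriv_def f'_def DERIV_imp_deriv)
qed

definition b1 :: "real \<Rightarrow> real \<Rightarrow> int \<Rightarrow> real" where
  "b1 \<alpha> \<beta> k =
    (if k < 0 then 0 else if k = 0 then 1 else if k = 1 \<and> \<alpha> = -1 \<and> \<beta> = -1 then 2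
     else (of_int k + \<alpha> + \<beta> + 1) / (2 * of_int k + \<alpha> + \<beta> + 1))"

definition b2 :: "real \<Rightarrow> real \<Rightarrow> int \<Rightarrow> real" where
  "b2 \<alpha> \<beta> k =
    (if k < 0 then 0 else if k = 0 then 0 else if k = 1 \<and> \<alpha> = -1 \<and> \<beta> = -1 then -1
     else - ((of_int k + \<beta>) / (2 * of_int k + \<alpha> + \<beta> + 1)))"

definition e1 :: "real \<Rightarrow> real \<Rightarrow> int \<Rightarrow> real" where
  "e1 \<alpha> \<beta> k =
    (if k < 0 then 0 else if k = 0 \<and> \<alpha> = -1 \<and> \<beta> = -1 then 1 / 2
     else if k = 1 \<and> \<alpha> = -1 \<and> \<beta> = -1 then 0
     else (of_int k + \<alpha> + 1) / (2 * of_int k + \<alpha> + \<beta> + 2))"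

definition e2 :: "real \<Rightarrow> real \<Rightarrow> int \<Rightarrow> real" where
  "e2 \<alpha> \<beta> k =
    (if k < 0 then 0 else if k = 0 \<and> \<alpha> = -1 \<and> \<beta> = -1 then - (1 / 2)
     else if k = 1 \<and> \<alpha> = -1 \<and> \<beta> = -1 then -1
     else - ((of_int k + 1) / (2 * of_int k + \<alpha> + \<beta> + 2)))"

definition dcoef :: "real \<Rightarrow> real \<Rightarrow> int \<Rightarrow> real" where
  "dcoef \<alpha> \<beta> k = (if k = 1 \<and> \<alpha> = -1 \<and> \<beta> = -1 then 1 else (of_int k + \<alpha> + \<beta> + 1) / 2)"

fun parA :: "int \<times> int \<times> int \<Rightarrow> real \<times> real \<times> real \<times> real \<Rightarrow> real" where
  "parA (l1, l2, l3) (\<alpha>0, \<alpha>1, \<alpha>2, \<alpha>3) = 2 * of_int l1 + \<alpha>0 + \<alpha>1 + 1"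

fun parB :: "int \<times> int \<times> int \<Rightarrow> real \<times> real \<times> real \<times> real \<Rightarrow> real" where
  "parB (l1, l2, l3) (\<alpha>0, \<alpha>1, \<alpha>2, \<alpha>3) = 2 * of_int l1 + 2 * of_int l2 + \<alpha>0 + \<alpha>1 + \<alpha>2 + 2"

fun rho :: "int \<times> int \<times> int \<Rightarrow> real \<times> real \<times> real \<times> real \<Rightarrow> real" where
  "rho (l1, l2, l3) (\<alpha>0, \<alpha>1, \<alpha>2, \<alpha>3) =
    2 * dcoef \<alpha>0 \<alpha>1 l1 * e1 \<alpha>1 (\<alpha>0 + 1) (l1 - 1) - of_int l1 * b2 \<alpha>0 \<alpha>1 l1"

fun kappa :: "int \<times> int \<times> int \<Rightarrow> real \<times> real \<times> real \<times> real \<Rightarrow> real" where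
  "kappa (l1, l2, l3) (\<alpha>0, \<alpha>1, \<alpha>2, \<alpha>3) =
    of_int l1 * b2 \<alpha>1 \<alpha>0 l1 - 2 * dcoef \<alpha>0 \<alpha>1 l1 * e1 \<alpha>0 (\<alpha>1 + 1) (l1 - 1)"

fun theta :: "int \<times> int \<times> int \<Rightarrow> real \<times> real \<times> real \<times> real \<Rightarrow> real" where
  "theta (l1, l2, l3) (\<alpha>0, \<alpha>1, \<alpha>2, \<alpha>3) =
    (let A = parA (l1, l2, l3) (\<alpha>0, \<alpha>1, \<alpha>2, \<alpha>3) in
      2 * dcoef A \<alpha>2 l2 * e1 \<alpha>2 (A + 1) (l2 - 1) - of_int l2 * b2 A \<alpha>2 l2)"

text \<open>
  In the coefficients below, \<open>p\<close> and \<open>q\<close> range over \<open>{0, 1}\<close> only. Some denominators can vanish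
  for admissible parameters, but then the coefficient multiplies a Koornwinder polynomial with a
  negative index, which is zero.
\<close>

fun D2 :: "int \<Rightarrow> int \<times> int \<times> int \<Rightarrow> real \<times> real \<times> real \<times> real \<Rightarrow> real" where
  "D2 p (l1, l2, l3) (\<alpha>0, \<alpha>1, \<alpha>2, \<alpha>3) =
    (let A = parA (l1, l2, l3) (\<alpha>0, \<alpha>1, \<alpha>2, \<alpha>3);
         \<rho> = rho (l1, l2, l3) (\<alpha>0, \<alpha>1, \<alpha>2, \<alpha>3)
     in if p = 0 then 2 * dcoef A \<alpha>2 l2 * b1 \<alpha>0 \<alpha>1 l1
        else (\<rho> * b1 A \<alpha>2 l2 + 2 * dcoef A \<alpha>2 l2 * b2 \<alpha>0 \<alpha>1 l1 * e2 A (\<alpha>2 + 1) (l2 - 1))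
             / b1 (A - 1) (\<alpha>2 + 1) l2)"

fun D21 :: "int \<Rightarrow> int \<times> int \<times> int \<Rightarrow> real \<times> real \<times> real \<times> real \<Rightarrow> real" where
  "D21 p (l1, l2, l3) (\<alpha>0, \<alpha>1, \<alpha>2, \<alpha>3) =
    (let A = parA (l1, l2, l3) (\<alpha>0, \<alpha>1, \<alpha>2, \<alpha>3);
         \<kappa> = kappa (l1, l2, l3) (\<alpha>0, \<alpha>1, \<alpha>2, \<alpha>3)
     in if p = 0 then D2 0 (l1, l2, l3) (\<alpha>0, \<alpha>1, \<alpha>2, \<alpha>3)
        else (\<kappa> * b1 A \<alpha>2 l2 - 2 * dcoef A \<alpha>2 l2 * b2 \<alpha>1 \<alpha>0 l1 * e2 A (\<alpha>2 + 1) (l2 - 1))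
             / b1 (A - 1) (\<alpha>2 + 1) l2)"

fun D3 :: "int \<Rightarrow> int \<Rightarrow> int \<times> int \<times> int \<Rightarrow> real \<times> real \<times> real \<times> real \<Rightarrow> real" where
  "D3 p q (l1, l2, l3) (\<alpha>0, \<alpha>1, \<alpha>2, \<alpha>3) =
    (let A = parA (l1, l2, l3) (\<alpha>0, \<alpha>1, \<alpha>2, \<alpha>3);
         B = parB (l1, l2, l3) (\<alpha>0, \<alpha>1, \<alpha>2, \<alpha>3);
         \<rho> = rho (l1, l2, l3) (\<alpha>0, \<alpha>1, \<alpha>2, \<alpha>3);
         \<theta> = theta (l1, l2, l3) (\<alpha>0, \<alpha>1, \<alpha>2, \<alpha>3)
     in if p = 0 \<and> q = 0 then 2 * dcoef B \<alpha>3 l3 * b1 \<alpha>0 \<alpha>1 l1 * b1 A \<alpha>2 l2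
        else if p = 0 then
          (b1 \<alpha>0 \<alpha>1 l1 * \<theta> * b1 B \<alpha>3 l3
             + 2 * dcoef B \<alpha>3 l3 * b1 \<alpha>0 \<alpha>1 l1 * b2 A \<alpha>2 l2 * e2 B (\<alpha>3 + 1) (l3 - 1))
          / b1 (B - 1) (\<alpha>3 + 1) l3
        else if q = 0 then 2 * dcoef B \<alpha>3 l3 * b2 \<alpha>0 \<alpha>1 l1 * e2 (A - 1) \<alpha>2 l2
        else
          ((\<rho> + b2 \<alpha>0 \<alpha>1 l1 * e2 A \<alpha>2 (l2 - 1) * \<theta>) * b1 B \<alpha>3 l3
             + 2 * b1 (A - 1) \<alpha>2 l2 * dcoef B \<alpha>3 l3 * b2 \<alpha>0 \<alpha>1 l1
                 * e1 (A - 1) \<alpha>2 l2 * e2 B (\<alpha>3 + 1) (l3 - 1))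
          / (b1 (A - 1) \<alpha>2 l2 * b1 (B - 1) (\<alpha>3 + 1) l3))"

fun D13 :: "int \<Rightarrow> int \<Rightarrow> int \<times> int \<times> int \<Rightarrow> real \<times> real \<times> real \<times> real \<Rightarrow> real" where
  "D13 p q (l1, l2, l3) (\<alpha>0, \<alpha>1, \<alpha>2, \<alpha>3) =
    (let A = parA (l1, l2, l3) (\<alpha>0, \<alpha>1, \<alpha>2, \<alpha>3);
         B = parB (l1, l2, l3) (\<alpha>0, \<alpha>1, \<alpha>2, \<alpha>3);
         \<kappa> = kappa (l1, l2, l3) (\<alpha>0, \<alpha>1, \<alpha>2, \<alpha>3);
         \<theta> = theta (l1, l2, l3) (\<alpha>0, \<alpha>1, \<alpha>2, \<alpha>3)
     in if p = 0 \<and> q = 0 then - D3 0 0 (l1, l2, l3) (\<alpha>0, \<alpha>1, \<alpha>2, \<alpha>3)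
        else if p = 0 then - D3 0 1 (l1, l2, l3) (\<alpha>0, \<alpha>1, \<alpha>2, \<alpha>3)
        else if q = 0 then 2 * dcoef B \<alpha>3 l3 * b2 \<alpha>1 \<alpha>0 l1 * e2 (A - 1) \<alpha>2 l2
        else
          ((b2 \<alpha>1 \<alpha>0 l1 * e2 A \<alpha>2 (l2 - 1) * \<theta> - \<kappa>) * b1 B \<alpha>3 l3
             + 2 * b1 (A - 1) \<alpha>2 l2 * dcoef B \<alpha>3 l3 * b2 \<alpha>1 \<alpha>0 l1
                 * e1 (A - 1) \<alpha>2 l2 * e2 B (\<alpha>3 + 1) (l3 - 1))
          / (b1 (A - 1) \<alpha>2 l2 * b1 (B - 1) (\<alpha>3 + 1) l3))"

fun D32 :: "int \<Rightarrow> int \<times> int \<times> int \<Rightarrow> real \<times> real \<times> real \<times> real \<Rightarrow> real" where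
  "D32 q (l1, l2, l3) (\<alpha>0, \<alpha>1, \<alpha>2, \<alpha>3) =
    (let A = parA (l1, l2, l3) (\<alpha>0, \<alpha>1, \<alpha>2, \<alpha>3);
         B = parB (l1, l2, l3) (\<alpha>0, \<alpha>1, \<alpha>2, \<alpha>3)
     in if q = 0 then 2 * dcoef B \<alpha>3 l3 * b1 A \<alpha>2 l2
        else
          ((of_int l2 * b2 \<alpha>2 A l2 - 2 * dcoef A \<alpha>2 l2 * e1 A (\<alpha>2 + 1) (l2 - 1)) * b1 B \<alpha>3 l3
             - 2 * dcoef B \<alpha>3 l3 * b2 \<alpha>2 A l2 * e2 B (\<alpha>3 + 1) (l3 - 1))
          / b1 (B - 1) (\<alpha>3 + 1) l3)"

end

theory Submission
  imports Defs
begin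

text \<open>
  In barycentric coordinates \<open>\<lambda>\<^sub>0 = 1 - x\<^sub>1 - x\<^sub>2 - x\<^sub>3\<close> and \<open>\<lambda>\<^sub>i = x\<^sub>i\<close>, a Koornwinder
  polynomial is a product of three binary forms: the Jacobi polynomials, homogenized in the pairs
  \<open>(X, Y)\<close> equal to \<open>(\<lambda>\<^sub>1, \<lambda>\<^sub>0)\<close>, \<open>(\<lambda>\<^sub>2, \<lambda>\<^sub>0 + \<lambda>\<^sub>1)\<close> and \<open>(\<lambda>\<^sub>3, \<lambda>\<^sub>0 + \<lambda>\<^sub>1 + \<lambda>\<^sub>2)\<close>. The six
  derivatives of the theorem are those along the edges of the tetrahedron, that is, differences
  of two barycentric derivatives.

  For a Jacobi form of degree \<open>k\<close> with parameters \<open>a\<close>, \<open>b\<close>, the derivative in \<open>X\<close> is \<open>k + a\<close> times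
  the form of degree \<open>k - 1\<close> with parameters \<open>a\<close>, \<open>b + 1\<close>; the derivative in \<open>Y\<close> is \<open>- (k + b)\<close>
  times the one with parameters \<open>a + 1\<close>, \<open>b\<close> (\<open>bary_jacobi_DERIV\<close>); for the exceptional form
  \<open>X - Y\<close> the weights are \<open>1\<close> and \<open>-1\<close>. Along the edge between the vertices 0 and 1 only the first
  factor varies, and \<open>bary_jacobi_raise_both\<close> gives the result. Along the other edges, the product
  rule gives a sum of products of Jacobi forms, some of them with parameters other than those of the
  Koornwinder polynomials on the right-hand side.

  Contiguous relations repair this. Let \<open>G'\<close> be the differentiated first factor. The first factor
  itself splits, up to signs, as \<open>b1 * G + b2 * (X + Y) * G'\<close> (\<open>bary_jacobi_raise_a\<close>, \<open>bary_jacobi_raise_b\<close>), where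
  \<open>G\<close> has the required parameters. The crucial point is that \<open>b2\<close>, up to sign, is the weight of the
  derivative divided by \<open>A\<close>, and \<open>A\<close> is the first parameter of the next factor
  (\<open>b2_eq_lowering_weight\<close>). Hence all terms with \<open>G'\<close> contain one and the same combination of the
  next factor and its derivative, and this combination is a single Jacobi form with parameter
  \<open>A - 1\<close> (\<open>bary_jacobi_lower_a_raise_b\<close>). This yields \<open>edge_relation\<close>, which covers the edges along
  which two factors vary; for the two edges along which all three vary, one more collapse in the
  middle factor is needed (\<open>face_relation\<close>). It also shows that the intricate coefficients have
  simple values, for instance \<open>\<rho> * (l\<^sub>2 + A) / A\<close> and \<open>\<rho> * (l\<^sub>2 + A) * (l\<^sub>3 + B) / (A * B)\<close> for the
  last ones of \<open>\<partial>\<^sub>2\<close> and \<open>\<partial>\<^sub>3\<close>, where \<open>\<rho> = l\<^sub>1 + \<alpha>\<^sub>1\<close> unless \<open>l\<^sub>1 = 1\<close> and \<open>\<alpha>\<^sub>0 = \<alpha>\<^sub>1 = -1\<close>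
  (\<open>edge_coeff_eq\<close>, \<open>face_coeff_eq\<close>).

  All contiguous relations are checked coefficientwise in \<open>w = - Y\<close> and \<open>s = X + Y\<close>: the
  coefficients are products of two Pochhammer symbols, so changes of degree and parameters only
  introduce linear factors. Vanishing denominators do no harm: \<open>A = 2 * l\<^sub>1 + \<alpha>\<^sub>0 + \<alpha>\<^sub>1 + 1\<close> is
  positive as soon as \<open>l\<^sub>1 \<ge> 1\<close>, and for \<open>l\<^sub>1 = 0\<close> the form \<open>G'\<close> has negative degree and is zero; the
  same holds for \<open>B\<close> when the second factor takes the place of the first.
\<close>

section \<open>Shift rules for the coefficients of Jacobi polynomials\<close>

text \<open>
  The product of two Pochhammer symbols whose values are the coefficients of a Jacobi polynomial.
  Degree, index and parameters of the polynomial enter only through the four arguments, so every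
  change of them is a sequence of the unit shifts below, each of which multiplies by a linear
  factor.
\<close>
definition poch_pair :: "real \<Rightarrow> nat \<Rightarrow> real \<Rightarrow> nat \<Rightarrow> real" where
  "poch_pair x i y j = pochhammer x i * pochhammer y j / (fact j * fact i)"

lemma pochhammer_shift: "x * pochhammer (x + 1) n = pochhammer x n * (x + of_nat n :: real)"
  by (metis pochhammer_Suc pochhammer_rec)

lemma poch_pair_0 [simp]: "poch_pair x 0 y 0 = 1" by (simp add: poch_pair_def)

lemma poch_pair_Suc_left: "(real i + 1) * poch_pair x (Suc i) y j =
  (x + real i) * poch_pair x i y j"
  by (simp add: poch_pair_def pochhammer_Suc divide_simps)

lemma poch_pair_Suc_right: "(real j + 1) * poch_pair x i y (Suc j) =
  (y + real j) * poch_pair x i y j"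
  by (simp add: poch_pair_def pochhammer_Suc divide_simps)

lemma poch_pair_shift_left: "x * poch_pair (x + 1) i y j = (x + real i) * poch_pair x i y j"
  using pochhammer_shift[of x i] by (simp add: poch_pair_def divide_simps)

lemma poch_pair_shift_right: "y * poch_pair x i (y + 1) j = (y + real j) * poch_pair x i y j"
  using pochhammer_shift[of y j] by (simp add: poch_pair_def divide_simps)

lemma poch_pair_rec_left: "(real i + 1) * poch_pair x (Suc i) y j = x * poch_pair (x + 1) i y j"
  by (simp add: poch_pair_Suc_left poch_pair_shift_left)

lemma poch_pair_rec_right: "(real j + 1) * poch_pair x i y (Suc j) = y * poch_pair x i (y + 1) j"
  by (simp add: poch_pair_Suc_right poch_pair_shift_right)

text \<open>
  Coefficients of the Jacobi polynomial in powers of \<open>(z - 1) / 2\<close>. The extension by zero to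
  \<open>j > k\<close> lets one sequence serve for the polynomial and for its product with a power of the
  homogenizing variable.
\<close>
definition jacobi_coeff :: "real \<Rightarrow> real \<Rightarrow> nat \<Rightarrow> nat \<Rightarrow> real" where
  "jacobi_coeff a b k j =
     (if j \<le> k then poch_pair (a + real j + 1) (k - j) (real k + a + b + 1) j else 0)"

lemma jacobi_coeff_eqI:
  assumes "k = j + i" "x = a + real j + 1" "y = real j + real i + a + b + 1"
  shows "jacobi_coeff a b k j = poch_pair x i y j"
  using assms by (simp add: jacobi_coeff_def)

lemma jacobi_coeff_gt [simp]: "k < j \<Longrightarrow> jacobi_coeff a b k j = 0"
  by (simp add: jacobi_coeff_def)

text \<open>
  The relations between coefficients that follow share one proof: with \<open>k = j + i\<close>, unit shifts
  reduce the coefficients involved to a common value of \<^const>\<open>poch_pair\<close>, and what remains is an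
  identity between polynomials in the parameters. An index at which one of the coefficients vanishes
  for reasons of degree is a separate case.
\<close>
lemma jacobi_coeff_deriv_s:
  assumes "j \<le> k"
  shows "real (Suc k - j) * jacobi_coeff a b (Suc k) j =
    (real k + 1 + a) * jacobi_coeff a (b + 1) k j"
proof -
  obtain i where k: "k = j + i" using assms le_Suc_ex by blast
  define x y where "x = a + real j + 1" and "y = real j + real i + a + b + 2"
  have "jacobi_coeff a b (Suc k) j = poch_pair x (Suc i) y j"
    "jacobi_coeff a (b + 1) k j = poch_pair x i y j"
    by (rule jacobi_coeff_eqI; simp add: k x_def y_def)+
  then show ?thesis using poch_pair_Suc_left[of i x y j] by (simp add: k x_def algebra_simps)
qed

lemma jacobi_coeff_deriv_w:
  "real (Suc j) * jacobi_coeff a b (Suc k) (Suc j) =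
    (real k + a + b + 2) * jacobi_coeff (a + 1) (b + 1) k j"
proof (cases "j \<le> k")
  case True
  obtain i where k: "k = j + i" using True le_Suc_ex by blast
  define x y where "x = a + real j + 2" and "y = real j + real i + a + b + 2"
  have "jacobi_coeff a b (Suc k) (Suc j) = poch_pair x i y (Suc j)"
     "jacobi_coeff (a + 1) (b + 1) k j = poch_pair x i (y + 1) j"
    by (rule jacobi_coeff_eqI; simp add: k x_def y_def)+
  then show ?thesis using poch_pair_rec_right[of j x i y] by (simp add: k y_def algebra_simps)
qed simp

lemma jacobi_coeff_raise_both:
  "(real k + a + b + 2) * jacobi_coeff (a + 1) (b + 1) k j =
   (real k + 1 + a) * jacobi_coeff a (b + 1) k j + (real k + 1 + b) * jacobi_coeff (a + 1) b k j"
proof (cases "j \<le> k")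
  case True
  obtain i where k: "k = j + i" using True le_Suc_ex by blast
  define x y where "x = a + real j + 1" and "y = real j + real i + a + b + 2"
  have "jacobi_coeff (a + 1) (b + 1) k j = poch_pair (x + 1) i (y + 1) j"
    "jacobi_coeff a (b + 1) k j = poch_pair x i y j"
      "jacobi_coeff (a + 1) b k j = poch_pair (x + 1) i y j"
    by (rule jacobi_coeff_eqI; simp add: k x_def y_def)+
  moreover have "real k + a + b + 2 = y" "real k + 1 + a = x + real i"
    "real k + 1 + b = y + real j - x"
    by (auto simp: k x_def y_def)
  moreover have "y * poch_pair (x + 1) i (y + 1) j =
    (x + real i) * poch_pair x i y j + (y + real j - x) * poch_pair (x + 1) i y j"
    using poch_pair_shift_left[of x i y j] poch_pair_shift_right[of y "x + 1" i j]
      by (simp add: algebra_simps)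
  ultimately show ?thesis by simp
qed simp

text \<open>
  Together with its counterpart for \<open>b\<close>, this is where \<open>b1\<close> and \<open>b2\<close> come from.
\<close>
lemma jacobi_coeff_raise_a:
  assumes "j \<le> Suc k"
  shows "(2 * real k + a + b + 3) * jacobi_coeff a b (Suc k) j =
   (real k + a + b + 2) * jacobi_coeff (a + 1) b (Suc k) j
     - (real k + 1 + b) * jacobi_coeff (a + 1) b k j"
proof (cases "j \<le> k")
  case True
  obtain i where k: "k = j + i" using True le_Suc_ex by blast
  define x y where "x = a + real j + 1" and "y = real j + real i + a + b + 2"
  have *: "jacobi_coeff a b (Suc k) j = poch_pair x (Suc i) y j"
    "jacobi_coeff (a + 1) b (Suc k) j = poch_pair (x + 1) (Suc i) (y + 1) j"
    "jacobi_coeff (a + 1) b k j = poch_pair (x + 1) i y j"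
    by (rule jacobi_coeff_eqI; simp add: k x_def y_def)+
  define T where "T = poch_pair (x + 1) i y j"
  have 1: "(real i + 1) * poch_pair x (Suc i) y j = x * T"
    unfolding T_def by (rule poch_pair_rec_left)
  have 2: "y * ((real i + 1) * poch_pair (x + 1) (Suc i) (y + 1) j) =
    (x + 1 + real i) * (y + real j) * T"
    unfolding T_def poch_pair_Suc_left using poch_pair_shift_right[of y "x + 1" i j] by algebra
  have "(real i + 1) * ((2 * real k + a + b + 3) * poch_pair x (Suc i) y j) =
    (real i + 1) * ((real k + a + b + 2) * poch_pair (x + 1) (Suc i) (y + 1) j
      - (real k + 1 + b) * T)"
  proof -
    have e: "2 * real k + a + b + 3 = y + real j + real i + 1" "real k + a + b + 2 = y"
      "real k + 1 + b = y + real j - x"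
      by (auto simp: k x_def y_def)
    show ?thesis unfolding e using 1 2 by algebra
  qed
  then show ?thesis unfolding * T_def[symmetric] by simp
next
  case False
  then have k: "j = Suc k" using assms by simp
  define x y where "x = a + real j + 1" and "y = real j + a + b + 1"
  have *: "jacobi_coeff a b (Suc k) j = poch_pair x 0 y j"
    "jacobi_coeff (a + 1) b (Suc k) j = poch_pair (x + 1) 0 (y + 1) j"
    by (rule jacobi_coeff_eqI; simp add: k x_def y_def)+
  have "poch_pair (x + 1) 0 (y + 1) j = poch_pair x 0 (y + 1) j" by (simp add: poch_pair_def)
  with * show ?thesis using poch_pair_shift_right[of y "x" 0 j]
    by (simp add: k y_def x_def algebra_simps)
qed

lemma jacobi_coeff_raise_b:
  assumes "j \<le> Suc k"
  shows "(2 * real k + a + b + 3) * jacobi_coeff a b (Suc k) j =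
   (real k + a + b + 2) * jacobi_coeff a (b + 1) (Suc k) j
     + (real k + 1 + a) * jacobi_coeff a (b + 1) k j"
proof (cases "j \<le> k")
  case True
  obtain i where k: "k = j + i" using True le_Suc_ex by blast
  define x y where "x = a + real j + 1" and "y = real j + real i + a + b + 2"
  have *: "jacobi_coeff a b (Suc k) j = poch_pair x (Suc i) y j"
    "jacobi_coeff a (b + 1) (Suc k) j = poch_pair x (Suc i) (y + 1) j"
    "jacobi_coeff a (b + 1) k j = poch_pair x i y j"
    by (rule jacobi_coeff_eqI; simp add: k x_def y_def)+
  have e: "2 * real k + a + b + 3 = y + real j + (real i + 1)" "real k + a + b + 2 = y"
    "real k + 1 + a = x + real i"
    by (auto simp: k x_def y_def)
  show ?thesis unfolding * e
    using poch_pair_Suc_left[of i x y j] poch_pair_shift_right[of y x "Suc i" j] by algebra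
next
  case False
  then have k: "j = Suc k" using assms by simp
  define x y where "x = a + real j + 1" and "y = real j + a + b + 1"
  have *: "jacobi_coeff a b (Suc k) j = poch_pair x 0 y j"
    "jacobi_coeff a (b + 1) (Suc k) j = poch_pair x 0 (y + 1) j"
    by (rule jacobi_coeff_eqI; simp add: k x_def y_def)+
  with * show ?thesis using poch_pair_shift_right[of y "x" 0 j]
    by (simp add: k y_def x_def algebra_simps)
qed

lemma jacobi_coeff_lower_a:
  "(a + real j) * jacobi_coeff a b k j = (real k + a) * jacobi_coeff (a - 1) (b + 1) k j"
proof (cases "j \<le> k")
  case True
  obtain i where k: "k = j + i" using True le_Suc_ex by blast
  define x y where "x = a + real j" and "y = real j + real i + a + b + 1"
  have *: "jacobi_coeff a b k j = poch_pair (x + 1) i y j"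
    "jacobi_coeff (a - 1) (b + 1) k j = poch_pair x i y j"
    by (rule jacobi_coeff_eqI; simp add: k x_def y_def)+
  show ?thesis unfolding *
    using poch_pair_shift_left[of x i y j] by (simp add: k x_def y_def algebra_simps)
qed simp

lemma jacobi_coeff_diff_b:
  "jacobi_coeff a (b + 1) (Suc k) (Suc j) - jacobi_coeff a b (Suc k) (Suc j) =
    jacobi_coeff (a + 1) (b + 1) k j"
proof (cases "j \<le> k")
  case True
  obtain i where k: "k = j + i" using True le_Suc_ex by blast
  define x y where "x = a + real j + 2" and "y = real j + real i + a + b + 2"
  have *: "jacobi_coeff a (b + 1) (Suc k) (Suc j) = poch_pair x i (y + 1) (Suc j)"
    "jacobi_coeff a b (Suc k) (Suc j) = poch_pair x i y (Suc j)"
    "jacobi_coeff (a + 1) (b + 1) k j = poch_pair x i (y + 1) j"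
    by (rule jacobi_coeff_eqI; simp add: k x_def y_def)+
  have "(real j + 1) * (poch_pair x i (y + 1) (Suc j) - poch_pair x i y (Suc j)) =
    (real j + 1) * poch_pair x i (y + 1) j"
    using poch_pair_rec_right[of j x i y] poch_pair_Suc_right[of j x i "y + 1"]
      by (simp add: algebra_simps)
  then show ?thesis unfolding * by simp
qed simp

lemma jacobi_coeff_0_b: "jacobi_coeff a b k 0 = jacobi_coeff a c k 0"
  by (simp add: jacobi_coeff_def poch_pair_def)

text \<open>
  This is where \<open>e1\<close> and \<open>e2\<close> come from.
\<close>
lemma jacobi_coeff_times_w:
  assumes "j \<le> k"
  shows "(2 * real k + a + b + 2) * jacobi_coeff (a + 1) b k j =
    (real k + 1) * jacobi_coeff a b (Suc k) (Suc j) - (real k + a + 1) * jacobi_coeff a b k (Suc j)"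
proof (cases "j = k")
  case False
  obtain i where k: "k = Suc j + i" using assms False
    by (metis le_neq_implies_less less_iff_Suc_add add_Suc)
  define x y where "x = a + real j + 2" and "y = real j + real i + a + b + 2"
  have *: "jacobi_coeff (a + 1) b k j = poch_pair x (Suc i) (y + 1) j"
    "jacobi_coeff a b (Suc k) (Suc j) = poch_pair x (Suc i) (y + 1) (Suc j)"
    "jacobi_coeff a b k (Suc j) = poch_pair x i y (Suc j)"
    by (rule jacobi_coeff_eqI; simp add: k x_def y_def)+
  have e: "2 * real k + a + b + 2 = y + real j + real i + 2" "real k + a + 1 = x + real i"
    "real k + 1 = real i + real j + 2"
    by (auto simp: k x_def y_def)
  define T where "T = poch_pair x (Suc i) (y + 1) j"
  have 1: "(real j + 1) * poch_pair x (Suc i) (y + 1) (Suc j) = (y + 1 + real j) * T"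
    unfolding T_def by (rule poch_pair_Suc_right)
  have 2: "(x + real i) * ((real j + 1) * poch_pair x i y (Suc j)) = y * (real i + 1) * T"
    unfolding T_def poch_pair_rec_right using poch_pair_Suc_left[of i x "y + 1" j] by algebra
  have "(real j + 1) * ((y + real j + real i + 2) * T) =
     (real j + 1) * ((real i + real j + 2) * poch_pair x (Suc i) (y + 1) (Suc j)
       - (x + real i) * poch_pair x i y (Suc j))"
    using 1 2 by algebra
  then show ?thesis unfolding * e T_def[symmetric] by simp
next
  case True
  define x y where "x = a + real j + 2" and "y = real j + a + b + 2"
  have *: "jacobi_coeff (a + 1) b k j = poch_pair x 0 y j"
    "jacobi_coeff a b (Suc k) (Suc j) = poch_pair x 0 y (Suc j)"
    by (rule jacobi_coeff_eqI; simp add: True[symmetric] x_def y_def)+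
  show ?thesis unfolding * using poch_pair_Suc_right[of j x 0 y]
    by (simp add: True[symmetric] y_def algebra_simps)
qed

lemma jacobi_coeff_times_w_0:
  "(real k + 1) * jacobi_coeff a b (Suc k) 0 = (real k + a + 1) * jacobi_coeff a b k 0"
  using poch_pair_Suc_left[of k "a + 1" 0 0]
    by (simp add: jacobi_coeff_def poch_pair_def algebra_simps)

section \<open>Jacobi polynomials as binary forms\<close>

definition binary_form :: "nat \<Rightarrow> (nat \<Rightarrow> real) \<Rightarrow> real \<Rightarrow> real \<Rightarrow> real" where
  "binary_form n c w s = (\<Sum>j\<le>n. c j * w ^ j * s ^ (n - j))"

lemma binary_form_cong: "(\<And>j. j \<le> n \<Longrightarrow> c j = c' j) \<Longrightarrow> binary_form n c w s = binary_form n c' w s"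
  by (simp add: binary_form_def)

lemma binary_form_scale: "x * binary_form n c w s = binary_form n (\<lambda>j. x * c j) w s"
  by (simp add: binary_form_def sum_distrib_left mult_ac)

lemma binary_form_add:
  "binary_form n c w s + binary_form n c' w s = binary_form n (\<lambda>j. c j + c' j) w s"
  by (simp add: binary_form_def sum.distrib algebra_simps)

lemma binary_form_diff:
  "binary_form n c w s - binary_form n c' w s = binary_form n (\<lambda>j. c j - c' j) w s"
  by (simp add: binary_form_def sum_subtractf algebra_simps)

text \<open>
  With the products by \<open>s\<close> and \<open>w\<close> written as forms of the next degree, a relation between forms of
  adjacent degrees becomes one between the coefficients of each power of \<open>w\<close>.
\<close>
lemma binary_form_times_s:
  assumes "c (Suc n) = 0"
  shows "s * binary_form n c w s = binary_form (Suc n) c w s"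
  using assms by (simp add: binary_form_def sum_distrib_left Suc_diff_le mult_ac)

lemma binary_form_times_w:
  "w * binary_form n c w s = binary_form (Suc n) (\<lambda>j. if j = 0 then 0 else c (j - 1)) w s"
  unfolding binary_form_def sum.atMost_Suc_shift
  by (simp add: sum_distrib_left mult_ac)

lemma binary_form_DERIV:
  fixes w s :: "real \<Rightarrow> real"
  assumes "(w has_real_derivative w') (at t)" "(s has_real_derivative s') (at t)"
  shows "((\<lambda>t. binary_form (Suc n) c (w t) (s t)) has_real_derivative
    binary_form n (\<lambda>j. real (Suc j) * c (Suc j)) (w t) (s t) * w' +
    binary_form n (\<lambda>j. real (Suc n - j) * c j) (w t) (s t) * s') (at t)"
proof -
  have "((\<lambda>t. binary_form (Suc n) c (w t) (s t)) has_real_derivative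
    (\<Sum>j\<le>Suc n. c j * (real j * w t ^ (j - 1) * w') * s t ^ (Suc n - j)
      + c j * w t ^ j * (real (Suc n - j) * s t ^ (n - j) * s'))) (at t)"
    unfolding binary_form_def
    by (rule DERIV_sum) (auto intro!: derivative_eq_intros assms simp: algebra_simps)
  also have "(\<Sum>j\<le>Suc n. c j * (real j * w t ^ (j - 1) * w') * s t ^ (Suc n - j)
      + c j * w t ^ j * (real (Suc n - j) * s t ^ (n - j) * s')) =
     (\<Sum>j\<le>Suc n. c j * (real j * w t ^ (j - 1) * w') * s t ^ (Suc n - j))
      + (\<Sum>j\<le>Suc n. c j * w t ^ j * (real (Suc n - j) * s t ^ (n - j) * s'))"
    by (rule sum.distrib)
  also have "(\<Sum>j\<le>Suc n. c j * (real j * w t ^ (j - 1) * w') * s t ^ (Suc n - j)) =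
      binary_form n (\<lambda>j. real (Suc j) * c (Suc j)) (w t) (s t) * w'"
    unfolding sum.atMost_Suc_shift binary_form_def sum_distrib_right
    by (simp add: algebra_simps)
  also have "(\<Sum>j\<le>Suc n. c j * w t ^ j * (real (Suc n - j) * s t ^ (n - j) * s')) =
     binary_form n (\<lambda>j. real (Suc n - j) * c j) (w t) (s t) * s'"
    by (simp add: binary_form_def sum_distrib_left sum_distrib_right mult_ac)
  finally show ?thesis .
qed

text \<open>
  The general formula for the Jacobi polynomial, homogenized to degree \<open>k\<close>, with \<open>(z - 1) / 2 = w / s\<close>.
\<close>
definition jacobi_form :: "real \<Rightarrow> real \<Rightarrow> nat \<Rightarrow> real \<Rightarrow> real \<Rightarrow> real" where
  "jacobi_form a b k w s = binary_form k (jacobi_coeff a b k) w s"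

lemma jacobi_form_times_s:
  "s * jacobi_form a b k w s = binary_form (Suc k) (jacobi_coeff a b k) w s"
  by (simp add: jacobi_form_def binary_form_times_s)

lemma jacobi_form_0 [simp]: "jacobi_form a b 0 w s = 1"
  by (simp add: jacobi_form_def binary_form_def jacobi_coeff_def)

lemma jacobi_form_DERIV:
  fixes w s :: "real \<Rightarrow> real"
  assumes "(w has_real_derivative w') (at t)" "(s has_real_derivative s') (at t)"
  shows "((\<lambda>t. jacobi_form a b (Suc k) (w t) (s t)) has_real_derivative
    (real k + a + b + 2) * jacobi_form (a + 1) (b + 1) k (w t) (s t) * w' +
    (real k + 1 + a) * jacobi_form a (b + 1) k (w t) (s t) * s') (at t)"
proof -
  have "binary_form k (\<lambda>j. real (Suc j) * jacobi_coeff a b (Suc k) (Suc j)) (w t) (s t)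
    = (real k + a + b + 2) * jacobi_form (a + 1) (b + 1) k (w t) (s t)"
    unfolding jacobi_form_def binary_form_scale jacobi_coeff_deriv_w ..
  moreover have "binary_form k (\<lambda>j. real (Suc k - j) * jacobi_coeff a b (Suc k) j) (w t) (s t)
    = (real k + 1 + a) * jacobi_form a (b + 1) k (w t) (s t)"
    unfolding jacobi_form_def binary_form_scale by (intro binary_form_cong jacobi_coeff_deriv_s)
  ultimately show ?thesis
    using binary_form_DERIV[OF assms, of k "jacobi_coeff a b (Suc k)"]
      by (simp add: jacobi_form_def)
qed

text \<open>
  This and the following contiguous relations, up to \<open>jacobi_form_lower_a_raise_b\<close>, hold because the
  relations between coefficients hold at every power of \<open>w\<close>.
\<close>
lemma jacobi_form_raise_both:
  "(real k + a + b + 2) * jacobi_form (a + 1) (b + 1) k w s =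
   (real k + 1 + a) * jacobi_form a (b + 1) k w s + (real k + 1 + b) * jacobi_form (a + 1) b k w s"
  by (simp only: jacobi_form_def binary_form_scale binary_form_add jacobi_coeff_raise_both)

lemma jacobi_form_raise_a:
  "(2 * real k + a + b + 3) * jacobi_form a b (Suc k) w s =
   (real k + a + b + 2) * jacobi_form (a + 1) b (Suc k) w s
     - (real k + 1 + b) * (s * jacobi_form (a + 1) b k w s)"
  unfolding jacobi_form_times_s unfolding jacobi_form_def binary_form_scale binary_form_diff
  by (intro binary_form_cong jacobi_coeff_raise_a)

lemma jacobi_form_raise_b:
  "(2 * real k + a + b + 3) * jacobi_form a b (Suc k) w s =
   (real k + a + b + 2) * jacobi_form a (b + 1) (Suc k) w s
     + (real k + 1 + a) * (s * jacobi_form a (b + 1) k w s)"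
  unfolding jacobi_form_times_s unfolding jacobi_form_def binary_form_scale binary_form_add
  by (intro binary_form_cong jacobi_coeff_raise_b)

lemma jacobi_form_diff_b:
  "jacobi_form a (b + 1) (Suc k) w s - jacobi_form a b (Suc k) w s =
    w * jacobi_form (a + 1) (b + 1) k w s"
  unfolding jacobi_form_def binary_form_times_w binary_form_diff
  by (intro binary_form_cong)
    (auto simp: jacobi_coeff_0_b[of a "b + 1" _ b] gr0_conv_Suc simp flip: jacobi_coeff_diff_b)

lemma jacobi_form_lower_a_raise_b:
  "a * jacobi_form a b (Suc k) w s
    + (real k + a + b + 2) * (w * jacobi_form (a + 1) (b + 1) k w s) =
   (real k + 1 + a) * jacobi_form (a - 1) (b + 1) (Suc k) w s"
proof -
  have "a * jacobi_coeff a b (Suc k) j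
      + (real k + a + b + 2) * (if j = 0 then 0 else jacobi_coeff (a + 1) (b + 1) k (j - 1))
    = (a + real j) * jacobi_coeff a b (Suc k) j" for j
  proof (cases j)
    case (Suc i)
    then show ?thesis using jacobi_coeff_deriv_w[of i a b k] by (simp add: algebra_simps)
  qed simp
  then show ?thesis
    unfolding jacobi_form_def binary_form_times_w binary_form_scale binary_form_add
    by (intro binary_form_cong) (simp add: jacobi_coeff_lower_a add.commute add.left_commute)
qed

text \<open>
  Raising \<open>b\<close> in the form with parameter \<open>a - 1\<close> changes it by \<open>w\<close> times a form of lower degree
  (\<open>jacobi_form_diff_b\<close>), and by \<open>jacobi_form_raise_both\<close> this change is what distinguishes the
  correction terms here and in \<open>jacobi_form_lower_a_raise_b\<close>.
\<close>
lemma jacobi_form_lower_a: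
  "a * jacobi_form a b (Suc k) w s + (real k + 1 + b) * (w * jacobi_form (a + 1) b k w s) =
   (real k + 1 + a) * jacobi_form (a - 1) b (Suc k) w s"
proof -
  have "jacobi_form (a - 1) (b + 1) (Suc k) w s - jacobi_form (a - 1) b (Suc k) w s =
    w * jacobi_form a (b + 1) k w s"
    using jacobi_form_diff_b[of "a - 1"] by simp
  then show ?thesis
    using jacobi_form_raise_both[of k a b w s] jacobi_form_lower_a_raise_b[of a b k w s] by algebra
qed

lemma jacobi_form_w:
  "(2 * real k + a + b + 2) * (w * jacobi_form (a + 1) b k w s) =
   (real k + 1) * jacobi_form a b (Suc k) w s - (real k + a + 1) * (s * jacobi_form a b k w s)"
proof -
  have "(2 * real k + a + b + 2) * (if j = 0 then 0 else jacobi_coeff (a + 1) b k (j - 1)) =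
     (real k + 1) * jacobi_coeff a b (Suc k) j - (real k + a + 1) * jacobi_coeff a b k j"
       if "j \<le> Suc k" for j
    using that by (cases j) (simp_all add: jacobi_coeff_times_w jacobi_coeff_times_w_0)
  then show ?thesis
    unfolding jacobi_form_times_s unfolding jacobi_form_def binary_form_times_w binary_form_scale
      binary_form_diff
    by (intro binary_form_cong)
qed

section \<open>Jacobi forms in barycentric variables\<close>

text \<open>
  The homogenized polynomial at \<open>z = (X - Y) / (X + Y)\<close>. In a Koornwinder polynomial, \<open>X\<close> is the
  barycentric coordinate of one vertex and \<open>Y\<close> the sum of those of the preceding vertices, starting
  with the vertex at the origin.
\<close>
definition bary_jacobi :: "real \<Rightarrow> real \<Rightarrow> int \<Rightarrow> real \<Rightarrow> real \<Rightarrow> real" where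
  "bary_jacobi a b k X Y = homog (nat k) (gjacobi a b k) (X - Y) (X + Y)"

text \<open>
  Where \<open>s = 0\<close> the quotient \<open>u / s\<close> has no meaning; both sides are continuous in \<open>s\<close>, so the
  identity extends from \<open>s \<noteq> 0\<close>.
\<close>
lemma homog_gjacobi:
  assumes "\<not> (k = 1 \<and> a = -1 \<and> b = -1)"
  shows "homog k (gjacobi a b (int k)) u s = jacobi_form a b k ((u - s) / 2) s"
proof -
  have *: "homog k (gjacobi a b (int k)) u s = jacobi_form a b k ((u - s) / 2) s" if "s \<noteq> 0" for s
  proof -
    have "homog k (gjacobi a b (int k)) u s = s ^ k * poly (gjacobi a b (int k)) (u / s)"
      using degree_gjacobi[of a b "int k"] that by (intro homog_quotient_form) auto
    also have "\<dots> = jacobi_form a b k ((u - s) / 2) s"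
    proof -
      have "s ^ k * (pochhammer (a + real j + 1) (k - j)
        * pochhammer (real k + a + b + 1) j / (fact j * fact (k - j)) * ((u / s - 1) / 2) ^ j)
        = jacobi_coeff a b k j * ((u - s) / 2) ^ j * s ^ (k - j)" if "j \<le> k" for j
      proof -
        have "s ^ k * ((u / s - 1) / 2) ^ j = ((u - s) / 2) ^ j * s ^ (k - j)"
        proof -
          have "(u - s) / 2 = s * ((u / s - 1) / 2)" using \<open>s \<noteq> 0\<close> by (simp add: field_simps)
          moreover have "s ^ k = s ^ j * s ^ (k - j)" using that by (simp flip: power_add)
          ultimately show ?thesis by (simp only: power_mult_distrib mult_ac)
        qed
        then show ?thesis using that by (simp add: jacobi_coeff_def poch_pair_def)
      qed
      then show ?thesis
        unfolding poly_gjacobi[OF assms] jacobi_form_def binary_form_def sum_distrib_left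
        by (intro sum.cong) auto
    qed
    finally show ?thesis .
  qed
  show ?thesis
  proof (cases "s = 0")
    case True
    have "((\<lambda>s. homog k (gjacobi a b (int k)) u s) \<longlongrightarrow> homog k (gjacobi a b (int k)) u 0) (at 0)"
      unfolding homog_def by (intro tendsto_intros)
    moreover have "((\<lambda>s. jacobi_form a b k ((u - s) / 2) s)
        \<longlongrightarrow> jacobi_form a b k ((u - 0) / 2) 0) (at 0)"
      unfolding jacobi_form_def binary_form_def by (intro tendsto_intros) auto
    moreover have "((\<lambda>s. homog k (gjacobi a b (int k)) u s) \<longlongrightarrow> l) (at 0) \<longleftrightarrow>
       ((\<lambda>s. jacobi_form a b k ((u - s) / 2) s) \<longlongrightarrow> l) (at 0)" for l
      by (rule Lim_cong_within) (auto simp: *)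
    ultimately show ?thesis using True tendsto_unique[of "at (0::real)"] by auto
  qed (rule *)
qed

lemma bary_jacobi_eq_jacobi_form:
  assumes "\<not> (k = 1 \<and> a = -1 \<and> b = -1)" "k \<ge> 0"
  shows "bary_jacobi a b k X Y = jacobi_form a b (nat k) (- Y) (X + Y)"
  using homog_gjacobi[of "nat k" a b "X - Y" "X + Y"] assms by (auto simp: bary_jacobi_def)

lemma bary_jacobi_neg [simp]: "k < 0 \<Longrightarrow> bary_jacobi a b k X Y = 0"
  by (simp add: bary_jacobi_def gjacobi_def homog_def)

lemma bary_jacobi_0 [simp]: "bary_jacobi a b 0 X Y = 1"
  by (simp add: bary_jacobi_eq_jacobi_form)

lemma bary_jacobi_exceptional: "bary_jacobi (-1) (-1) 1 X Y = X - Y"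
  by (simp add: bary_jacobi_def gjacobi_def homog_def)

text \<open>
  The factor picked up by differentiating in \<open>Y\<close>, up to sign. The first branch is the exceptional
  polynomial \<open>J\<^sub>1 = z\<close> for parameters \<open>-1\<close>, whose form is \<open>X - Y\<close>.
\<close>
definition lowering_weight :: "real \<Rightarrow> real \<Rightarrow> int \<Rightarrow> real" where
  "lowering_weight a b k = (if k = 1 \<and> a = -1 \<and> b = -1 then 1 else of_int k + b)"

lemma int_zero_or_Suc:
  fixes k :: int
  assumes "k \<ge> 0"
  obtains "k = 0" | n where "k = int (Suc n)"
  using assms by (metis nonneg_int_cases not0_implies_Suc of_nat_0)

lemma dcoef_commute: "dcoef a b k = dcoef b a k"
  by (simp add: dcoef_def algebra_simps)

lemma bary_jacobi_Suc_eq_jacobi_form: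
  assumes "\<not> (n = 0 \<and> a = -1 \<and> b = -1)"
  shows "bary_jacobi a b (1 + int n) X Y = jacobi_form a b (Suc n) (- Y) (X + Y)"
  using assms by (subst bary_jacobi_eq_jacobi_form) (auto simp: nat_add_distrib)

lemma bary_jacobi_int_eq_jacobi_form:
  assumes "a > -1 \<or> b > -1"
  shows "bary_jacobi a b (int n) X Y = jacobi_form a b n (- Y) (X + Y)"
  using assms by (subst bary_jacobi_eq_jacobi_form) auto

lemma bary_jacobi_linear:
  assumes "a > -1 \<or> b > -1"
  shows "bary_jacobi a b 1 X Y = (a + 1) * X - (b + 1) * Y"
  using bary_jacobi_int_eq_jacobi_form[OF assms, of 1]
  by (simp add: jacobi_form_def binary_form_def jacobi_coeff_def poch_pair_def algebra_simps)

text \<open>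
  Either partial derivative lowers the degree and raises only the parameter that belongs to the other
  variable. In the variables \<open>w = - Y\<close> and \<open>s = X + Y\<close>, the derivative in \<open>X\<close> is the one in \<open>s\<close>,
  while that in \<open>Y\<close> is the difference of those in \<open>s\<close> and \<open>w\<close>, which is a single form by
  \<open>jacobi_form_raise_both\<close>. The bounds on the parameters keep the derivative from being of
  exceptional type.
\<close>
lemma bary_jacobi_DERIV:
  fixes X Y :: "real \<Rightarrow> real"
  assumes "(X has_real_derivative X') (at t)" "(Y has_real_derivative Y') (at t)"
    and ab: "a \<ge> -1" "b \<ge> -1" and "k \<ge> 0"
  shows "((\<lambda>t. bary_jacobi a b k (X t) (Y t)) has_real_derivative
    lowering_weight b a k * bary_jacobi a (b + 1) (k - 1) (X t) (Y t) * X' -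
    lowering_weight a b k * bary_jacobi (a + 1) b (k - 1) (X t) (Y t) * Y') (at t)"
  using \<open>k \<ge> 0\<close>
proof (cases rule: int_zero_or_Suc)
  case 1
  then show ?thesis by simp
next
  case k: (2 n)
  show ?thesis
  proof (cases "k = 1 \<and> a = -1 \<and> b = -1")
    case True
    then show ?thesis using assms
      by (auto simp: bary_jacobi_exceptional lowering_weight_def intro!: derivative_eq_intros)
  next
    case False
    define w s where "w = (\<lambda>t. - Y t)" and "s = (\<lambda>t. X t + Y t)"
    have D: "((\<lambda>t. jacobi_form a b (Suc n) (w t) (s t)) has_real_derivative
      (real n + a + b + 2) * jacobi_form (a + 1) (b + 1) n (w t) (s t) * (- Y') +
      (real n + 1 + a) * jacobi_form a (b + 1) n (w t) (s t) * (X' + Y')) (at t)"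
      unfolding w_def s_def by (intro jacobi_form_DERIV derivative_intros assms)
    have "(real n + a + b + 2) * jacobi_form (a + 1) (b + 1) n (w t) (s t) * (- Y') +
      (real n + 1 + a) * jacobi_form a (b + 1) n (w t) (s t) * (X' + Y') =
      (real n + 1 + a) * jacobi_form a (b + 1) n (w t) (s t) * X' -
      (real n + 1 + b) * jacobi_form (a + 1) b n (w t) (s t) * Y'"
      unfolding jacobi_form_raise_both by (simp add: algebra_simps)
    moreover have "lowering_weight a b k = real n + 1 + b" "lowering_weight b a k = real n + 1 + a"
      using False k by (auto simp: lowering_weight_def)
    ultimately show ?thesis
      using D False k ab by (simp add: bary_jacobi_Suc_eq_jacobi_form bary_jacobi_int_eq_jacobi_form
        w_def s_def)
  qed
qed

text \<open>
  The right-hand side is the derivative of the form of degree \<open>k\<close> in the direction \<open>(1, -1)\<close>, which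
  keeps \<open>X + Y\<close> constant; this is the differentiation formula for Jacobi polynomials in one variable.
\<close>
lemma bary_jacobi_raise_both:
  assumes "a \<ge> -1" "b \<ge> -1" "k \<ge> 0"
  shows "2 * dcoef a b k * bary_jacobi (a + 1) (b + 1) (k - 1) X Y =
    lowering_weight b a k * bary_jacobi a (b + 1) (k - 1) X Y
      + lowering_weight a b k * bary_jacobi (a + 1) b (k - 1) X Y"
  using \<open>k \<ge> 0\<close>
proof (cases rule: int_zero_or_Suc)
  case k: (2 n)
  show ?thesis
  proof (cases "k = 1 \<and> a = -1 \<and> b = -1")
    case False
    then have "2 * dcoef a b k = real n + a + b + 2"
      "lowering_weight a b k = real n + 1 + b" "lowering_weight b a k = real n + 1 + a"
      using k by (auto simp: lowering_weight_def dcoef_def)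
    then show ?thesis
      using jacobi_form_raise_both[of n a b "- Y" "X + Y"] k assms
        by (simp add: bary_jacobi_int_eq_jacobi_form)
  qed (simp add: dcoef_def lowering_weight_def)
qed simp

text \<open>
  For \<open>k = 1\<close> and both parameters equal to \<open>-1\<close>, the exceptional values of \<open>b1\<close> and \<open>b2\<close> express
  \<open>X - Y = 2 * X - (X + Y)\<close>. In all other cases with \<open>k \<ge> 1\<close> this is \<open>jacobi_form_raise_a\<close> divided
  by \<open>2 * k + a + b + 1\<close>, which is positive.
\<close>
lemma bary_jacobi_raise_a:
  assumes "a \<ge> -1" "b \<ge> -1" "k \<ge> 0"
  shows "bary_jacobi a b k X Y = b1 a b k * bary_jacobi (a + 1) b k X Y
    + b2 a b k * (X + Y) * bary_jacobi (a + 1) b (k - 1) X Y"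
  using \<open>k \<ge> 0\<close>
proof (cases rule: int_zero_or_Suc)
  case k: (2 n)
  show ?thesis
  proof (cases "k = 1 \<and> a = -1 \<and> b = -1")
    case True
    then show ?thesis by (auto simp: bary_jacobi_exceptional bary_jacobi_linear b1_def b2_def)
  next
    case False
    then have pos: "2 * real n + a + b + 3 > 0" using k assms by (cases n) auto
    have b: "b1 a b k = (real n + a + b + 2) / (2 * real n + a + b + 3)"
      "b2 a b k = - ((real n + 1 + b) / (2 * real n + a + b + 3))"
      using False k by (auto simp: b1_def b2_def algebra_simps)
    show ?thesis unfolding b
      using jacobi_form_raise_a[of n a b "- Y" "X + Y"] pos k assms False
      by (simp add: bary_jacobi_Suc_eq_jacobi_form bary_jacobi_int_eq_jacobi_form divide_simps)
        (simp add: algebra_simps)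
  qed
qed (simp add: b1_def)

lemma bary_jacobi_raise_b:
  assumes "a \<ge> -1" "b \<ge> -1" "k \<ge> 0"
  shows "bary_jacobi a b k X Y = b1 a b k * bary_jacobi a (b + 1) k X Y
    - b2 b a k * (X + Y) * bary_jacobi a (b + 1) (k - 1) X Y"
  using \<open>k \<ge> 0\<close>
proof (cases rule: int_zero_or_Suc)
  case k: (2 n)
  show ?thesis
  proof (cases "k = 1 \<and> a = -1 \<and> b = -1")
    case True
    then show ?thesis by (auto simp: bary_jacobi_exceptional bary_jacobi_linear b1_def b2_def)
  next
    case False
    then have pos: "2 * real n + a + b + 3 > 0" using k assms by (cases n) auto
    have b: "b1 a b k = (real n + a + b + 2) / (2 * real n + a + b + 3)"
      "b2 b a k = - ((real n + 1 + a) / (2 * real n + a + b + 3))"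
      using False k by (auto simp: b1_def b2_def algebra_simps)
    show ?thesis unfolding b
      using jacobi_form_raise_b[of n a b "- Y" "X + Y"] pos k assms False
      by (simp add: bary_jacobi_Suc_eq_jacobi_form bary_jacobi_int_eq_jacobi_form divide_simps)
        (simp add: algebra_simps)
  qed
qed (simp add: b1_def)

text \<open>
  This relation and \<open>bary_jacobi_lower_a\<close> collapse a combination of a form and one of lower degree
  into a single form with smaller first parameter. Positivity of \<open>a\<close> excludes the exceptional
  polynomial on either side.
\<close>
lemma bary_jacobi_lower_a_raise_b:
  assumes "a > 0" "b \<ge> -1" "k \<ge> 0"
  shows "a * bary_jacobi a b k X Y - 2 * dcoef a b k * Y * bary_jacobi (a + 1) (b + 1) (k - 1) X Y
    = (of_int k + a) * bary_jacobi (a - 1) (b + 1) k X Y"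
  using \<open>k \<ge> 0\<close>
proof (cases rule: int_zero_or_Suc)
  case k: (2 n)
  have "2 * dcoef a b k = real n + a + b + 2" using assms k by (simp add: dcoef_def)
  then show ?thesis
    using jacobi_form_lower_a_raise_b[of a b n "- Y" "X + Y"] k assms
    by (simp add: bary_jacobi_Suc_eq_jacobi_form bary_jacobi_int_eq_jacobi_form add_ac)
qed simp

lemma bary_jacobi_lower_a:
  assumes "a > 0" "b \<ge> -1" "k \<ge> 0"
  shows "a * bary_jacobi a b k X Y - lowering_weight a b k * Y * bary_jacobi (a + 1) b (k - 1) X Y
    = (of_int k + a) * bary_jacobi (a - 1) b k X Y"
  using \<open>k \<ge> 0\<close>
proof (cases rule: int_zero_or_Suc)
  case k: (2 n)
  have "lowering_weight a b k = real n + 1 + b" using assms k by (simp add: lowering_weight_def)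
  then show ?thesis
    using jacobi_form_lower_a[of a b n "- Y" "X + Y"] k assms
    by (simp add: bary_jacobi_Suc_eq_jacobi_form bary_jacobi_int_eq_jacobi_form add_ac)
qed simp

lemma bary_jacobi_times_Y:
  assumes "a > 0" "b \<ge> -1" "k \<ge> 0"
  shows "Y * bary_jacobi a b k X Y =
    e1 (a - 1) b k * (X + Y) * bary_jacobi (a - 1) b k X Y
      + e2 (a - 1) b k * bary_jacobi (a - 1) b (k + 1) X Y"
proof -
  obtain n where k: "k = int n" using \<open>k \<ge> 0\<close> nonneg_int_cases by blast
  have pos: "2 * real n + a + b + 1 > 0" using assms by auto
  have e: "e1 (a - 1) b k = (real n + a) / (2 * real n + a + b + 1)"
     "e2 (a - 1) b k = - ((real n + 1) / (2 * real n + a + b + 1))"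
    using k assms by (auto simp: e1_def e2_def algebra_simps)
  have "bary_jacobi (a - 1) b (k + 1) X Y = jacobi_form (a - 1) b (Suc n) (- Y) (X + Y)"
    using assms k by (subst bary_jacobi_eq_jacobi_form) (auto simp: nat_add_distrib)
  then show ?thesis unfolding e
    using jacobi_form_w[of n "a - 1" b "- Y" "X + Y"] pos assms k
    by (simp add: bary_jacobi_int_eq_jacobi_form bary_jacobi_eq_jacobi_form divide_simps)
      (simp add: algebra_simps)
qed

section \<open>Closed forms of the coefficients\<close>

text \<open>
  The expressions \<open>\<rho>\<close>, \<open>\<theta>\<close> and \<open>- \<kappa>\<close> of the theorem are the weights of the partial derivatives;
  this holds only for positive degree, but in degree zero they multiply a zero form.
\<close>
lemma rho_eq_lowering_weight:
  assumes "a \<ge> -1" "b \<ge> -1" "k \<ge> 1"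
  shows "2 * dcoef a b k * e1 b (a + 1) (k - 1) - of_int k * b2 a b k = lowering_weight a b k"
proof (cases "k = 1 \<and> a = -1 \<and> b = -1")
  case False
  then have "2 * of_int k + a + b > -1 + 1" using assms by (cases "k = 1") auto
  with False show ?thesis using assms
    by (auto simp: dcoef_def e1_def b2_def lowering_weight_def divide_simps;
      simp add: algebra_simps)
qed (simp add: dcoef_def e1_def b2_def lowering_weight_def)

text \<open>
  The denominator is the first parameter of the next Jacobi factor. This coincidence is what makes
  the contribution of the derivative and that of the splitting by \<open>b1\<close> and \<open>b2\<close> combine.
\<close>
lemma b2_eq_lowering_weight:
  assumes "k \<ge> 1"
  shows "b2 a b k = - (lowering_weight a b k / (2 * of_int k + a + b + 1))"
  using assms by (auto simp: b2_def lowering_weight_def)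

text \<open>
  The common shape of the coefficients \<open>D2\<close>, \<open>D21\<close> and \<open>D32\<close> with index one, and a factor of \<open>D3\<close>
  and \<open>D13\<close> with indices zero and one. For \<open>D2\<close>, \<open>r\<close> is \<open>\<rho>\<close> and \<open>q\<close> is the \<open>b2\<close> of the preceding
  Jacobi factor; for \<open>D21\<close>, \<open>r\<close> is \<open>\<kappa>\<close> and \<open>q\<close> is the negative of that \<open>b2\<close> with its parameters
  interchanged.
\<close>
definition edge_coeff :: "real \<Rightarrow> real \<Rightarrow> real \<Rightarrow> real \<Rightarrow> int \<Rightarrow> real" where
  "edge_coeff r q a b k =
     (r * b1 a b k + 2 * dcoef a b k * q * e2 a (b + 1) (k - 1)) / b1 (a - 1) (b + 1) k"

lemma edge_coeff_eq:
  assumes "a > 0" "b \<ge> -1" "k \<ge> 0"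
  shows "edge_coeff r (- (r / a)) a b k = r * (of_int k + a) / a"
proof (cases "k = 0")
  case False
  define D where "D = 2 * of_int k + a + b + 1"
  define N where "N = of_int k + a + b + 1"
  have "N > 0" "D > 0" using assms False unfolding N_def D_def by auto
  moreover have "b1 a b k = N / D" "2 * dcoef a b k = N" "e2 a (b + 1) (k - 1) = - (of_int k / D)"
      "b1 (a - 1) (b + 1) k = N / D"
    using assms False by (auto simp: b1_def dcoef_def e2_def N_def D_def algebra_simps)
  ultimately show ?thesis
    unfolding edge_coeff_def using \<open>a > 0\<close> by (simp only:) (simp add: field_simps)
qed (use assms in \<open>simp add: edge_coeff_def b1_def e2_def\<close>)

text \<open>
  The common shape, up to sign, of the coefficients \<open>D3\<close> and \<open>D13\<close> with both indices one.
\<close>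
definition face_coeff :: "real \<Rightarrow> real \<Rightarrow> real \<Rightarrow> real \<Rightarrow> real \<Rightarrow> int \<Rightarrow> real \<Rightarrow> real \<Rightarrow> int \<Rightarrow> real" where
  "face_coeff r q \<theta> a b k c d m =
     ((r + q * e2 a b (k - 1) * \<theta>) * b1 c d m
        + 2 * b1 (a - 1) b k * dcoef c d m * q * e1 (a - 1) b k * e2 c (d + 1) (m - 1))
     / (b1 (a - 1) b k * b1 (c - 1) (d + 1) m)"

lemma face_coeff_numerator:
  assumes "a > 0" "b \<ge> -1" "k \<ge> 0" and "k \<ge> 1 \<Longrightarrow> \<theta> = lowering_weight a b k"
  shows "r + (- (r / a)) * e2 a b (k - 1) * \<theta> = b1 (a - 1) b k * (r * (of_int k + a) / a)"
proof (cases "k = 0")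
  case False
  define D where "D = 2 * of_int k + a + b"
  have "D > 0" using assms False unfolding D_def by auto
  moreover have "e2 a b (k - 1) = - (of_int k / D)" "\<theta> = of_int k + b"
    "b1 (a - 1) b k = (of_int k + a + b) / D"
    using assms False by (auto simp: b1_def lowering_weight_def e2_def D_def algebra_simps)
  moreover have "r * (a * D) + r * of_int k * (of_int k + b) =
    (of_int k + a + b) * (r * (of_int k + a))"
    by (simp add: D_def algebra_simps)
  ultimately show ?thesis using \<open>a > 0\<close> by (simp only:) (simp add: divide_simps algebra_simps)
qed (use assms in \<open>simp add: b1_def e2_def\<close>)

text \<open>
  The factor \<^term>\<open>b1 (a - 1) b k\<close> cancels against the denominator, and the quotient that remains is
  an \<^const>\<open>edge_coeff\<close> with \<open>r\<close> replaced by \<open>r * (k + a) / a\<close>.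
\<close>
lemma face_coeff_eq:
  assumes "a > 0" "b \<ge> -1" "k \<ge> 0" "d \<ge> -1" "m \<ge> 0" "k \<ge> 1 \<Longrightarrow> \<theta> = lowering_weight a b k"
    and c: "c = 2 * of_int k + a + b + 1"
  shows "face_coeff r (- (r / a)) \<theta> a b k c d m = r * (of_int k + a) / a * (of_int m + c) / c"
proof -
  have "c > 0" using assms by auto
  define r' where "r' = r * (of_int k + a) / a"
  have b: "b1 (a - 1) b k \<noteq> 0"
    using assms by (cases "k = 0") (auto simp: b1_def)
  have e: "e1 (a - 1) b k = (of_int k + a) / c"
    using assms by (auto simp: e1_def algebra_simps)
  have "r + (- (r / a)) * e2 a b (k - 1) * \<theta> = b1 (a - 1) b k * r'"
    unfolding r'_def by (rule face_coeff_numerator) (use assms in auto)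
  moreover have "(- (r / a)) * e1 (a - 1) b k = - (r' / c)"
    by (simp add: e r'_def)
  ultimately have "face_coeff r (- (r / a)) \<theta> a b k c d m =
    (b1 (a - 1) b k * (r' * b1 c d m + 2 * dcoef c d m * (- (r' / c)) * e2 c (d + 1) (m - 1)))
     / (b1 (a - 1) b k * b1 (c - 1) (d + 1) m)"
    unfolding face_coeff_def by (intro arg_cong2[where f = "(/)"] refl) algebra
  also have "\<dots> = r' * (of_int m + c) / c"
    using b edge_coeff_eq[OF \<open>c > 0\<close> \<open>d \<ge> -1\<close> \<open>m \<ge> 0\<close>, of r'] by (simp add: edge_coeff_def)
  finally show ?thesis by (simp add: r'_def)
qed

section \<open>Derivatives of products of Jacobi forms\<close>

text \<open>
  The left-hand side is the derivative of a product of \<open>F\<close> with the next Jacobi form in a direction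
  that moves weight from one of the earlier vertices to the vertex of that form: \<open>r * G'\<close> is the
  derivative of \<open>F\<close>, and \<open>s\<close> the sum of the earlier barycentric coordinates. Splitting \<open>F\<close> in the
  second term gives one product of the required type, and since \<open>q = - r / a\<close> the rest is
  \<open>r / a * G'\<close> times the combination that \<open>bary_jacobi_lower_a_raise_b\<close> collapses.
\<close>
lemma edge_relation:
  assumes F: "F = \<beta> * G + q * s * G'" and q: "G' = 0 \<or> (a > 0 \<and> q = - (r / a))"
    and "b \<ge> -1" "k \<ge> 0"
  shows "r * G' * bary_jacobi a b k X s
    + F * (2 * dcoef a b k * bary_jacobi (a + 1) (b + 1) (k - 1) X s) =
    2 * dcoef a b k * \<beta> * (G * bary_jacobi (a + 1) (b + 1) (k - 1) X s) +
    edge_coeff r q a b k * (G' * bary_jacobi (a - 1) (b + 1) k X s)"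
  using q
proof
  assume *: "a > 0 \<and> q = - (r / a)"
  have e: "edge_coeff r q a b k = r * (of_int k + a) / a"
    using edge_coeff_eq[of a b k r] * assms by simp
  have "(of_int k + a) * bary_jacobi (a - 1) (b + 1) k X s =
     a * bary_jacobi a b k X s - 2 * dcoef a b k * s * bary_jacobi (a + 1) (b + 1) (k - 1) X s"
    using bary_jacobi_lower_a_raise_b[of a b k X s] * assms by simp
  then have "r * (of_int k + a) / a * (G' * bary_jacobi (a - 1) (b + 1) k X s) =
    r / a * G' * (a * bary_jacobi a b k X s
      - 2 * dcoef a b k * s * bary_jacobi (a + 1) (b + 1) (k - 1) X s)"
    by (simp add: mult_ac)
  then show ?thesis unfolding e F using * by (simp add: field_simps)
qed (simp add: F)

text \<open>
  A Jacobi form meets the hypotheses of \<open>edge_relation\<close> with respect to its derivative in \<open>Y\<close>, and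
  by \<open>bary_jacobi_split_b\<close> also with respect to its derivative in \<open>X\<close>. The positivity of \<open>A\<close> can
  fail only for \<open>k = 0\<close>, when \<open>G'\<close> is zero.
\<close>
lemma bary_jacobi_split_a:
  fixes k :: nat and a b X Y :: real
  assumes "a \<ge> -1" "b \<ge> -1"
  defines "G' \<equiv> bary_jacobi (a + 1) b (int k - 1) X Y" and "A \<equiv> 2 * real k + a + b + 1"
    and "r \<equiv> 2 * dcoef a b (int k) * e1 b (a + 1) (int k - 1) - real k * b2 a b (int k)"
  shows "bary_jacobi a b (int k) X Y =
    b1 a b (int k) * bary_jacobi (a + 1) b (int k) X Y + b2 a b (int k) * (X + Y) * G'"
    and "G' = 0 \<or> (A > 0 \<and> b2 a b (int k) = - (r / A))"
    and "lowering_weight a b (int k) * G' = r * G'"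
proof -
  have r: "r = lowering_weight a b (int k)" if "k > 0"
    using rho_eq_lowering_weight[of a b "int k"] that assms by simp
  show "bary_jacobi a b (int k) X Y =
    b1 a b (int k) * bary_jacobi (a + 1) b (int k) X Y + b2 a b (int k) * (X + Y) * G'"
    unfolding G'_def by (rule bary_jacobi_raise_a) (use assms in auto)
  show "lowering_weight a b (int k) * G' = r * G'"
    using r by (cases "k = 0") (simp_all add: G'_def)
  show "G' = 0 \<or> (A > 0 \<and> b2 a b (int k) = - (r / A))"
    using b2_eq_lowering_weight[of "int k" a b] r assms(1,2)
      by (cases "k = 0") (auto simp: G'_def A_def)
qed

lemma bary_jacobi_split_b:
  fixes k :: nat and a b X Y :: real
  assumes "a \<ge> -1" "b \<ge> -1"
  defines "G' \<equiv> bary_jacobi a (b + 1) (int k - 1) X Y" and "A \<equiv> 2 * real k + a + b + 1"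
    and "r \<equiv> real k * b2 b a (int k) - 2 * dcoef a b (int k) * e1 a (b + 1) (int k - 1)"
  shows "bary_jacobi a b (int k) X Y =
    b1 a b (int k) * bary_jacobi a (b + 1) (int k) X Y + (- b2 b a (int k)) * (X + Y) * G'"
    and "G' = 0 \<or> (A > 0 \<and> - b2 b a (int k) = - (r / A))"
    and "lowering_weight b a (int k) * G' = - r * G'"
proof -
  have r: "r = - lowering_weight b a (int k)" if "k > 0"
    using rho_eq_lowering_weight[of b a "int k"] that assms by (simp add: dcoef_commute[of b])
  show "bary_jacobi a b (int k) X Y =
    b1 a b (int k) * bary_jacobi a (b + 1) (int k) X Y + (- b2 b a (int k)) * (X + Y) * G'"
    unfolding G'_def by (subst bary_jacobi_raise_b) (use assms in auto)
  show "lowering_weight b a (int k) * G' = - r * G'"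
    using r by (cases "k = 0") (simp_all add: G'_def)
  show "G' = 0 \<or> (A > 0 \<and> - b2 b a (int k) = - (r / A))"
    using b2_eq_lowering_weight[of "int k" b a] r assms(1,2)
      by (cases "k = 0") (auto simp: G'_def A_def add_ac)
qed

text \<open>
  The same with one more Jacobi form in between. The bracket multiplied by \<open>F\<close> is the derivative of
  the last two forms, so the part \<open>\<beta> * G\<close> of \<open>F\<close> is a case of \<open>edge_relation\<close>. In the part with
  \<open>q * s * G'\<close>, the product of \<open>s\<close> with the middle form is expanded by \<open>bary_jacobi_times_Y\<close>, which
  accounts for the form of degree \<open>k + 1\<close>; the terms that remain collapse by
  \<open>bary_jacobi_lower_a\<close> in the middle form and then by \<open>bary_jacobi_lower_a_raise_b\<close> in the last one.
\<close>
lemma face_relation: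
  fixes k m :: nat and a b c d X Y s t :: real
  assumes F: "F = \<beta> * G + q * s * G'" and q: "G' = 0 \<or> (a > 0 \<and> q = - (r / a))"
    and ab: "a \<ge> -1" "b \<ge> -1" "d \<ge> -1" and c: "c = 2 * real k + a + b + 1" and t: "t = X + s"
  defines "\<theta> \<equiv> 2 * dcoef a b (int k) * e1 b (a + 1) (int k - 1) - real k * b2 a b (int k)"
    and "H \<equiv> bary_jacobi (c + 1) (d + 1) (int m - 1) Y t"
  shows "r * G' * bary_jacobi a b (int k) X s * bary_jacobi c d (int m) Y t
      + F * (lowering_weight a b (int k) * bary_jacobi (a + 1) b (int k - 1) X s
        * bary_jacobi c d (int m) Y t
             + bary_jacobi a b (int k) X s * (2 * dcoef c d (int m) * H)) =
    2 * dcoef c d (int m) * \<beta> * b1 a b (int k) * (G * bary_jacobi (a + 1) b (int k) X s * H) +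
    \<beta> * edge_coeff \<theta> (b2 a b (int k)) c d (int m) *
      (G * bary_jacobi (a + 1) b (int k - 1) X s * bary_jacobi (c - 1) (d + 1) (int m) Y t) +
    2 * dcoef c d (int m) * q * e2 (a - 1) b (int k)
      * (G' * bary_jacobi (a - 1) b (int k + 1) X s * H) +
    face_coeff r q \<theta> a b (int k) c d (int m) *
      (G' * bary_jacobi (a - 1) b (int k) X s * bary_jacobi (c - 1) (d + 1) (int m) Y t)"
proof -
  define F2 F3 G2 G2' H3 where "F2 = bary_jacobi a b (int k) X s"
    and "F3 = bary_jacobi c d (int m) Y t"
    and "G2 = bary_jacobi (a + 1) b (int k) X s" and "G2' = bary_jacobi (a + 1) b (int k - 1) X s"
    and "H3 = bary_jacobi (c - 1) (d + 1) (int m) Y t"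
  define \<delta> where "\<delta> = 2 * dcoef c d (int m)"
  define w where "w = lowering_weight a b (int k)"
  note split = bary_jacobi_split_a[OF ab(1,2), where k = k and X = X and Y = s,
    folded \<theta>_def c t F2_def G2_def G2'_def w_def]
  have pair: "w * G2' * F3 + F2 * (\<delta> * H) =
    \<delta> * b1 a b (int k) * (G2 * H) + edge_coeff \<theta> (b2 a b (int k)) c d (int m) * (G2' * H3)"
    unfolding F3_def H_def H3_def split(3) \<delta>_def
    by (rule edge_relation) (use split ab in auto)
  have triple: "r * G' * F2 * F3 + q * s * G' * (w * G2' * F3 + F2 * (\<delta> * H)) =
    \<delta> * q * e2 (a - 1) b (int k) * (G' * bary_jacobi (a - 1) b (int k + 1) X s * H) +
    face_coeff r q \<theta> a b (int k) c d (int m) * (G' * bary_jacobi (a - 1) b (int k) X s * H3)"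
    using q
  proof
    assume "a > 0 \<and> q = - (r / a)"
    then have a: "a > 0" and q: "q = - (r / a)" by auto
    have "c > 0" using a ab c by auto
    have \<theta>: "\<theta> = lowering_weight a b (int k)" if "int k \<ge> 1"
      using rho_eq_lowering_weight[of a b "int k"] that ab unfolding \<theta>_def by simp
    have f: "face_coeff r q \<theta> a b (int k) c d (int m) = r * (real k + a) / a * (real m + c) / c"
      unfolding q by (subst face_coeff_eq) (use a ab \<theta> c in auto)
    define K K' e where "K = bary_jacobi (a - 1) b (int k) X s"
      and "K' = bary_jacobi (a - 1) b (int k + 1) X s"
      and "e = e2 (a - 1) b (int k)"
    have 1: "a * F2 - w * s * G2' = (real k + a) * K"
      using bary_jacobi_lower_a[of a b "int k" X s] a ab
        unfolding F2_def w_def G2'_def K_def by simp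
    have e1: "e1 (a - 1) b (int k) = (real k + a) / c"
      using a c ab by (auto simp: e1_def algebra_simps)
    have 2: "s * F2 = (real k + a) / c * t * K + e * K'"
      using bary_jacobi_times_Y[of a b "int k" s X] a ab
        unfolding F2_def K_def K'_def e_def e1 t by simp
    have 3: "c * F3 - \<delta> * t * H = (real m + c) * H3"
      using bary_jacobi_lower_a_raise_b[of c d "int m" Y t] \<open>c > 0\<close> ab
        unfolding F3_def \<delta>_def H_def H3_def by simp
    have "r * G' * F2 * F3 + q * s * G' * (w * G2' * F3 + F2 * (\<delta> * H)) =
      r / a * G' * ((a * F2 - w * s * G2') * F3 - (s * F2) * (\<delta> * H))"
      using a by (simp add: q field_simps)
    also have "\<dots> = r / a * G' * ((real k + a) / c * K * (c * F3 - \<delta> * t * H) - e * K' * (\<delta> * H))"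
      unfolding 1 2 using \<open>c > 0\<close> by (simp add: field_simps)
    also have "\<dots> = \<delta> * q * e * (G' * K' * H)
      + r * (real k + a) / a * (real m + c) / c * (G' * K * H3)"
      unfolding 3 q using a \<open>c > 0\<close> by (simp add: field_simps)
    finally show ?thesis unfolding f K_def K'_def e_def .
  qed simp
  have "r * G' * F2 * F3 + F * (w * G2' * F3 + F2 * (\<delta> * H)) =
    \<beta> * G * (w * G2' * F3 + F2 * (\<delta> * H))
      + (r * G' * F2 * F3 + q * s * G' * (w * G2' * F3 + F2 * (\<delta> * H)))"
    unfolding F by (simp add: algebra_simps)
  also have "\<dots> = \<beta> * G
    * (\<delta> * b1 a b (int k) * (G2 * H) + edge_coeff \<theta> (b2 a b (int k)) c d (int m) * (G2' * H3)) +
    (\<delta> * q * e2 (a - 1) b (int k) * (G' * bary_jacobi (a - 1) b (int k + 1) X s * H) +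
    face_coeff r q \<theta> a b (int k) c d (int m) * (G' * bary_jacobi (a - 1) b (int k) X s * H3))"
    by (simp only: triple) (simp only: pair)
  finally show ?thesis
    unfolding F2_def[symmetric] F3_def[symmetric] G2_def[symmetric] G2'_def[symmetric]
      H3_def[symmetric] \<delta>_def[symmetric] w_def[symmetric]
    by (simp add: algebra_simps)
qed

section \<open>Derivatives of Koornwinder polynomials\<close>

lemma koornwinder_eq_bary_jacobi:
  assumes "A = 2 * of_int l1 + \<alpha>0 + \<alpha>1 + 1" "B = 2 * of_int l1 + 2 * of_int l2 + \<alpha>0 + \<alpha>1 + \<alpha>2 + 2"
  shows "koornwinder (\<alpha>0, \<alpha>1, \<alpha>2, \<alpha>3) (l1, l2, l3) x =
    bary_jacobi \<alpha>0 \<alpha>1 l1 (x $ 1) (1 - x $ 1 - x $ 2 - x $ 3)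
      * bary_jacobi A \<alpha>2 l2 (x $ 2) (1 - x $ 2 - x $ 3) *
    bary_jacobi B \<alpha>3 l3 (x $ 3) (1 - x $ 3)"
proof (cases "l1 < 0 \<or> l2 < 0 \<or> l3 < 0")
  case False
  have 1: "bary_jacobi a b k X (s - X) = homog (nat k) (gjacobi a b k) (2 * X - s) s" for a b k X s
    by (simp add: bary_jacobi_def algebra_simps)
  have 2: "bary_jacobi a b k X (1 - X) = poly (gjacobi a b k) (2 * X - 1)" for a b k X
    using homog_quotient_form[OF degree_gjacobi[of a b k], of 1 "2 * X - 1"] 1[of a b k X 1] by simp
  show ?thesis
    using False 1[of \<alpha>0 \<alpha>1 l1 "x $ 1" "1 - x $ 2 - x $ 3"]
      1[of A \<alpha>2 l2 "x $ 2" "1 - x $ 3"] 2[of B \<alpha>3 l3 "x $ 3"]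
    by (simp add: Let_def assms algebra_simps)
qed auto

text \<open>
  The product and chain rules. In the last factor the two arguments add up to one, so only the
  derivative in the direction \<open>(1, -1)\<close> occurs there.
\<close>
lemma partial_deriv_koornwinder:
  fixes x :: "real ^ 3" and l1 l2 l3 :: nat and i :: 3 and \<alpha>0 \<alpha>1 \<alpha>2 \<alpha>3 :: real
  assumes "\<alpha>0 \<ge> -1" "\<alpha>1 \<ge> -1" "\<alpha>2 \<ge> -1" "\<alpha>3 \<ge> -1"
  defines "A \<equiv> 2 * real l1 + \<alpha>0 + \<alpha>1 + 1" and "B \<equiv> 2 * real l1 + 2 * real l2 + \<alpha>0 + \<alpha>1 + \<alpha>2 + 2"
    and "P1 \<equiv> (\<lambda>a b k. bary_jacobi a b k (x $ 1) (1 - x $ 1 - x $ 2 - x $ 3))"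
    and "P2 \<equiv> (\<lambda>a b k. bary_jacobi a b k (x $ 2) (1 - x $ 2 - x $ 3))"
    and "P3 \<equiv> (\<lambda>a b k. bary_jacobi a b k (x $ 3) (1 - x $ 3))"
    and "c \<equiv> (\<lambda>j. axis i 1 $ j)"
  shows "partial_deriv i (koornwinder (\<alpha>0, \<alpha>1, \<alpha>2, \<alpha>3) (int l1, int l2, int l3)) x =
    (lowering_weight \<alpha>1 \<alpha>0 (int l1) * P1 \<alpha>0 (\<alpha>1 + 1) (int l1 - 1) * c 1
       + lowering_weight \<alpha>0 \<alpha>1 (int l1) * P1 (\<alpha>0 + 1) \<alpha>1 (int l1 - 1) * (c 1 + c 2 + c 3))
      * P2 A \<alpha>2 (int l2) * P3 B \<alpha>3 (int l3)
    + P1 \<alpha>0 \<alpha>1 (int l1) * (lowering_weight \<alpha>2 A (int l2) * P2 A (\<alpha>2 + 1) (int l2 - 1) * c 2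
       + lowering_weight A \<alpha>2 (int l2) * P2 (A + 1) \<alpha>2 (int l2 - 1) * (c 2 + c 3))
         * P3 B \<alpha>3 (int l3)
    + P1 \<alpha>0 \<alpha>1 (int l1) * P2 A \<alpha>2 (int l2) *
       (2 * dcoef B \<alpha>3 (int l3) * P3 (B + 1) (\<alpha>3 + 1) (int l3 - 1) * c 3)"
proof -
  have AB: "A \<ge> -1" "B \<ge> -1" using assms by (auto simp: A_def B_def)
  define y where "y = (\<lambda>t j. x $ j + t * c j)"
  have y0: "y 0 j = x $ j" for j by (simp add: y_def)
  have y: "(x + t *\<^sub>R axis i 1) $ j = y t j" for t j by (simp add: y_def c_def)
  have Dy: "((\<lambda>t. y t j) has_real_derivative c j) (at 0)" for j
    unfolding y_def by (auto intro!: derivative_eq_intros)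
  have Dy': "((\<lambda>t. 1 - y t 1 - y t 2 - y t 3) has_real_derivative - (c 1 + c 2 + c 3)) (at 0)"
     "((\<lambda>t. 1 - y t 2 - y t 3) has_real_derivative - (c 2 + c 3)) (at 0)"
     "((\<lambda>t. 1 - y t 3) has_real_derivative - c 3) (at 0)"
    by (auto intro!: derivative_eq_intros Dy)
  define f1 f2 f3 where "f1 = (\<lambda>t. bary_jacobi \<alpha>0 \<alpha>1 (int l1) (y t 1) (1 - y t 1 - y t 2 - y t 3))"
    and "f2 = (\<lambda>t. bary_jacobi A \<alpha>2 (int l2) (y t 2) (1 - y t 2 - y t 3))"
    and "f3 = (\<lambda>t. bary_jacobi B \<alpha>3 (int l3) (y t 3) (1 - y t 3))"
  have D1: "(f1 has_real_derivative
       lowering_weight \<alpha>1 \<alpha>0 (int l1) * P1 \<alpha>0 (\<alpha>1 + 1) (int l1 - 1) * c 1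
       + lowering_weight \<alpha>0 \<alpha>1 (int l1) * P1 (\<alpha>0 + 1) \<alpha>1 (int l1 - 1) * (c 1 + c 2 + c 3)) (at 0)"
    unfolding f1_def P1_def
    by (rule DERIV_cong[OF bary_jacobi_DERIV[OF Dy Dy'(1)]])
      (use assms(1-4) in \<open>auto simp: y0 algebra_simps\<close>)
  have D2: "(f2 has_real_derivative
       lowering_weight \<alpha>2 A (int l2) * P2 A (\<alpha>2 + 1) (int l2 - 1) * c 2
       + lowering_weight A \<alpha>2 (int l2) * P2 (A + 1) \<alpha>2 (int l2 - 1) * (c 2 + c 3)) (at 0)"
    unfolding f2_def P2_def
    by (rule DERIV_cong[OF bary_jacobi_DERIV[OF Dy Dy'(2)]])
      (use assms(1-4) AB in \<open>auto simp: y0 algebra_simps\<close>)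
  have D3: "(f3 has_real_derivative
       2 * dcoef B \<alpha>3 (int l3) * P3 (B + 1) (\<alpha>3 + 1) (int l3 - 1) * c 3) (at 0)"
  proof -
    have r: "2 * dcoef B \<alpha>3 (int l3) * P3 (B + 1) (\<alpha>3 + 1) (int l3 - 1) =
      lowering_weight \<alpha>3 B (int l3) * P3 B (\<alpha>3 + 1) (int l3 - 1)
        + lowering_weight B \<alpha>3 (int l3) * P3 (B + 1) \<alpha>3 (int l3 - 1)"
      unfolding P3_def by (rule bary_jacobi_raise_both) (use assms(4) AB in auto)
    show ?thesis
      unfolding r unfolding f3_def P3_def
      by (rule DERIV_cong[OF bary_jacobi_DERIV[OF Dy Dy'(3)]])
        (use assms(1-4) AB in \<open>auto simp: y0 algebra_simps\<close>)
  qed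
  have "partial_deriv i (koornwinder (\<alpha>0, \<alpha>1, \<alpha>2, \<alpha>3) (int l1, int l2, int l3)) x =
    deriv (\<lambda>t. f1 t * f2 t * f3 t) 0"
    unfolding partial_deriv_def f1_def f2_def f3_def
    by (subst koornwinder_eq_bary_jacobi[of A _ _ _ B])
      (simp_all only: A_def B_def y of_int_of_nat_eq)
  moreover have "f1 0 = P1 \<alpha>0 \<alpha>1 (int l1)" "f2 0 = P2 A \<alpha>2 (int l2)" "f3 0 = P3 B \<alpha>3 (int l3)"
    by (simp_all add: f1_def f2_def f3_def P1_def P2_def P3_def y0)
  ultimately show ?thesis
    using DERIV_imp_deriv[OF DERIV_mult[OF DERIV_mult[OF D1 D2] D3]] by (simp add: algebra_simps)
qed

theorem lemmaB1:
  fixes \<alpha>0 \<alpha>1 \<alpha>2 \<alpha>3 :: real and l1 l2 l3 :: nat and x :: "real ^ 3"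
    and \<alpha> :: "real \<times> real \<times> real \<times> real" and l :: "int \<times> int \<times> int"
  assumes "\<alpha> = (\<alpha>0, \<alpha>1, \<alpha>2, \<alpha>3)"
    and "\<alpha>0 \<ge> -1" "\<alpha>1 \<ge> -1" "\<alpha>2 \<ge> -1" "\<alpha>3 \<ge> -1"
    and "l = (int l1, int l2, int l3)"
    and "x \<in> ref_tetrahedron"
  shows "
     (partial_deriv 1 (koornwinder \<alpha> l) x =
        2 * dcoef \<alpha>0 \<alpha>1 (int l1) * koornwinder (\<alpha> + (1, 1, 0, 0)) (l - (1, 0, 0)) x) \<and>
     (partial_deriv 2 (koornwinder \<alpha> l) x =
        (\<Sum>p=0..1. D2 p l \<alpha> * koornwinder (\<alpha> + (1, 0, 1, 0)) (l - (p, 1 - p, 0)) x)) \<and>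
     (partial_deriv 2 (koornwinder \<alpha> l) x - partial_deriv 1 (koornwinder \<alpha> l) x =
        (\<Sum>p=0..1. D21 p l \<alpha> * koornwinder (\<alpha> + (0, 1, 1, 0)) (l - (p, 1 - p, 0)) x)) \<and>
     (partial_deriv 3 (koornwinder \<alpha> l) x =
        (\<Sum>p=0..1. \<Sum>q=0..1. D3 p q l \<alpha> * koornwinder (\<alpha> + (1, 0, 0, 1)) (l - (p, q - p, 1 - q)) x)) \<and>
     (partial_deriv 1 (koornwinder \<alpha> l) x - partial_deriv 3 (koornwinder \<alpha> l) x =
        (\<Sum>p=0..1. \<Sum>q=0..1. D13 p q l \<alpha> * koornwinder (\<alpha> + (0, 1, 0, 1)) (l - (p, q - p, 1 - q)) x)) \<and>
     (partial_deriv 3 (koornwinder \<alpha> l) x - partial_deriv 2 (koornwinder \<alpha> l) x =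
        (\<Sum>q=0..1. D32 q l \<alpha> * koornwinder (\<alpha> + (0, 0, 1, 1)) (l - (0, q, 1 - q)) x))"
proof -
  note \<alpha> = assms(1) and bounds = assms(2-5) and l = assms(6)
  define A B where "A = 2 * real l1 + \<alpha>0 + \<alpha>1 + 1"
    and "B = 2 * real l1 + 2 * real l2 + \<alpha>0 + \<alpha>1 + \<alpha>2 + 2"
  have AB: "A \<ge> -1" "B = 2 * real l2 + A + \<alpha>2 + 1" "B \<ge> -1"
    using bounds by (auto simp: A_def B_def)
  \<comment> \<open>Sums of the barycentric coordinates of the vertices preceding vertex 1, 2 and 3.\<close>
  define Y1 Y2 Y3 where "Y1 = 1 - x $ 1 - x $ 2 - x $ 3" and "Y2 = 1 - x $ 2 - x $ 3"
    and "Y3 = 1 - x $ 3"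
  have Y: "Y2 = x $ 1 + Y1" "Y3 = x $ 2 + Y2" by (simp_all add: Y1_def Y2_def Y3_def)
  define P1 P2 P3 where "P1 = (\<lambda>a b k. bary_jacobi a b k (x $ 1) Y1)"
    and "P2 = (\<lambda>a b k. bary_jacobi a b k (x $ 2) Y2)"
    and "P3 = (\<lambda>a b k. bary_jacobi a b k (x $ 3) Y3)"
  have P: "bary_jacobi a b k (x $ 1) Y1 = P1 a b k" "bary_jacobi a b k (x $ 2) Y2 = P2 a b k"
    "bary_jacobi a b k (x $ 3) Y3 = P3 a b k"
    for a b k by (simp_all add: P1_def P2_def P3_def)
  define m1 m2 m3 where "m1 = int l1" and "m2 = int l2" and "m3 = int l3"
  define F1 F2 F3 where "F1 = P1 \<alpha>0 \<alpha>1 m1" and "F2 = P2 A \<alpha>2 m2" and "F3 = P3 B \<alpha>3 m3"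
  \<comment> \<open>\<open>X1\<close>, \<open>X2\<close> are the derivatives of the first two factors in \<open>X\<close>; \<open>U1\<close>, \<open>U2\<close> those in \<open>- Y\<close>.\<close>
  define X1 U1 X2 U2 where "X1 = lowering_weight \<alpha>1 \<alpha>0 m1 * P1 \<alpha>0 (\<alpha>1 + 1) (m1 - 1)"
    and "U1 = lowering_weight \<alpha>0 \<alpha>1 m1 * P1 (\<alpha>0 + 1) \<alpha>1 (m1 - 1)"
    and "X2 = lowering_weight \<alpha>2 A m2 * P2 A (\<alpha>2 + 1) (m2 - 1)"
    and "U2 = lowering_weight A \<alpha>2 m2 * P2 (A + 1) \<alpha>2 (m2 - 1)"
  \<comment> \<open>The derivatives of the last two factors in the direction \<open>(1, -1)\<close>.\<close>
  define V2 V3 where "V2 = 2 * dcoef A \<alpha>2 m2 * P2 (A + 1) (\<alpha>2 + 1) (m2 - 1)"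
    and "V3 = 2 * dcoef B \<alpha>3 m3 * P3 (B + 1) (\<alpha>3 + 1) (m3 - 1)"
  have V2: "X2 + U2 = V2"
    unfolding V2_def X2_def U2_def P2_def m2_def using AB bounds
      by (simp add: bary_jacobi_raise_both)
  have V1: "X1 + U1 = 2 * dcoef \<alpha>0 \<alpha>1 m1 * P1 (\<alpha>0 + 1) (\<alpha>1 + 1) (m1 - 1)"
    unfolding X1_def U1_def P1_def m1_def using bounds by (simp add: bary_jacobi_raise_both)
  have d1: "partial_deriv 1 (koornwinder \<alpha> l) x = (X1 + U1) * F2 * F3"
   and d2: "partial_deriv 2 (koornwinder \<alpha> l) x = (U1 * F2 + F1 * V2) * F3"
   and d3: "partial_deriv 3 (koornwinder \<alpha> l) x = U1 * F2 * F3 + F1 * (U2 * F3 + F2 * V3)"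
    unfolding V2[symmetric] using partial_deriv_koornwinder[OF bounds, of _ l1 l2 l3 x]
    by (simp_all add: \<alpha> l axis_def X1_def U1_def X2_def U2_def V3_def F1_def F2_def F3_def
      P1_def P2_def P3_def m1_def m2_def m3_def A_def B_def Y1_def Y2_def Y3_def algebra_simps)
  have K: "koornwinder (a0, a1, a2, a3) (k1, k2, k3) x = P1 a0 a1 k1 * P2 A' a2 k2 * P3 B' a3 k3"
    if "A' = 2 * of_int k1 + a0 + a1 + 1" "B' = 2 * of_int k1 + 2 * of_int k2 + a0 + a1 + a2 + 2"
    for a0 a1 a2 a3 k1 k2 k3 A' B'
    unfolding P1_def P2_def P3_def Y1_def Y2_def Y3_def using that
      by (rule koornwinder_eq_bary_jacobi)
  have sum_01: "(\<Sum>p=0..1. f p) = f 0 + f 1" for f :: "int \<Rightarrow> real"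
  proof -
    have "{0..1::int} = {0, 1}" by auto
    then show ?thesis by simp
  qed
  note split_a1 = bary_jacobi_split_a[OF bounds(1,2), of l1 "x $ 1" Y1, folded m1_def Y A_def]
  note split_b1 = bary_jacobi_split_b[OF bounds(1,2), of l1 "x $ 1" Y1, folded m1_def Y A_def]
  note split_b2 = bary_jacobi_split_b[OF AB(1) bounds(3), of l2 "x $ 2" Y2, folded m2_def Y AB(2)]
  let ?\<rho> = "rho l \<alpha>" and ?\<kappa> = "kappa l \<alpha>" and ?\<theta> = "theta l \<alpha>"
  let ?\<kappa>2 = "of_int m2 * b2 \<alpha>2 A m2 - 2 * dcoef A \<alpha>2 m2 * e1 A (\<alpha>2 + 1) (m2 - 1)"
  have \<rho>: "?\<rho> = 2 * dcoef \<alpha>0 \<alpha>1 m1 * e1 \<alpha>1 (\<alpha>0 + 1) (m1 - 1) - real l1 * b2 \<alpha>0 \<alpha>1 m1"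
    and \<kappa>: "?\<kappa> = real l1 * b2 \<alpha>1 \<alpha>0 m1 - 2 * dcoef \<alpha>0 \<alpha>1 m1 * e1 \<alpha>0 (\<alpha>1 + 1) (m1 - 1)"
    and \<theta>: "?\<theta> = 2 * dcoef A \<alpha>2 m2 * e1 \<alpha>2 (A + 1) (m2 - 1) - real l2 * b2 A \<alpha>2 m2"
    by (simp_all add: \<alpha> l m1_def m2_def A_def Let_def)
  have U1: "U1 = ?\<rho> * P1 (\<alpha>0 + 1) \<alpha>1 (m1 - 1)"
    unfolding U1_def \<rho> P1_def by (rule split_a1)
  have X1: "X1 = - ?\<kappa> * P1 \<alpha>0 (\<alpha>1 + 1) (m1 - 1)"
    unfolding X1_def \<kappa> P1_def by (rule split_b1)
  have X2: "X2 = - ?\<kappa>2 * P2 A (\<alpha>2 + 1) (m2 - 1)"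
    using split_b2(3) unfolding X2_def P2_def by (simp add: m2_def)

  have E1: "partial_deriv 1 (koornwinder \<alpha> l) x =
        2 * dcoef \<alpha>0 \<alpha>1 (int l1) * koornwinder (\<alpha> + (1, 1, 0, 0)) (l - (1, 0, 0)) x"
  proof -
    have "koornwinder (\<alpha> + (1, 1, 0, 0)) (l - (1, 0, 0)) x =
      koornwinder (\<alpha>0 + 1, \<alpha>1 + 1, \<alpha>2, \<alpha>3) (m1 - 1, m2, m3) x"
      by (simp add: \<alpha> l m1_def m2_def m3_def del: koornwinder.simps)
    also have "\<dots> = P1 (\<alpha>0 + 1) (\<alpha>1 + 1) (m1 - 1) * F2 * F3"
      unfolding F2_def F3_def by (rule K) (auto simp: A_def B_def m1_def m2_def)
    finally show ?thesis unfolding d1 V1 m1_def[symmetric] by simp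
  qed
  have E2: "partial_deriv 2 (koornwinder \<alpha> l) x =
        (\<Sum>p=0..1. D2 p l \<alpha> * koornwinder (\<alpha> + (1, 0, 1, 0)) (l - (p, 1 - p, 0)) x)"
  proof -
    have k: "koornwinder (\<alpha> + (1, 0, 1, 0)) (l - (p, 1 - p, 0)) x =
      P1 (\<alpha>0 + 1) \<alpha>1 (m1 - p) * P2 (A + 1 - 2 * of_int p) (\<alpha>2 + 1) (m2 - 1 + p) * F3" for p
    proof -
      have "koornwinder (\<alpha> + (1, 0, 1, 0)) (l - (p, 1 - p, 0)) x =
        koornwinder (\<alpha>0 + 1, \<alpha>1, \<alpha>2 + 1, \<alpha>3) (m1 - p, m2 - 1 + p, m3) x"
        by (simp add: \<alpha> l m1_def m2_def m3_def algebra_simps del: koornwinder.simps)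
      then show ?thesis
        unfolding F3_def by (simp only:) (rule K; simp add: A_def B_def m1_def m2_def)
    qed
    have D: "D2 0 l \<alpha> = 2 * dcoef A \<alpha>2 m2 * b1 \<alpha>0 \<alpha>1 m1"
      "D2 1 l \<alpha> = edge_coeff ?\<rho> (b2 \<alpha>0 \<alpha>1 m1) A \<alpha>2 m2"
      by (simp_all add: \<alpha> l m1_def m2_def A_def Let_def edge_coeff_def)
    have "?\<rho> * P1 (\<alpha>0 + 1) \<alpha>1 (m1 - 1) * F2 + F1 * V2 =
      2 * dcoef A \<alpha>2 m2 * b1 \<alpha>0 \<alpha>1 m1 * (P1 (\<alpha>0 + 1) \<alpha>1 m1 * P2 (A + 1) (\<alpha>2 + 1) (m2 - 1)) +
      edge_coeff ?\<rho> (b2 \<alpha>0 \<alpha>1 m1) A \<alpha>2 m2 * (P1 (\<alpha>0 + 1) \<alpha>1 (m1 - 1) * P2 (A - 1) (\<alpha>2 + 1) m2)"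
      unfolding F1_def F2_def V2_def P1_def P2_def \<rho>
      by (rule edge_relation[OF split_a1(1,2)]) (use bounds in \<open>auto simp: m2_def\<close>)
    then show ?thesis unfolding d2 sum_01 k D U1 by (simp add: algebra_simps)
  qed
  have E3: "partial_deriv 2 (koornwinder \<alpha> l) x - partial_deriv 1 (koornwinder \<alpha> l) x =
        (\<Sum>p=0..1. D21 p l \<alpha> * koornwinder (\<alpha> + (0, 1, 1, 0)) (l - (p, 1 - p, 0)) x)"
  proof -
    have k: "koornwinder (\<alpha> + (0, 1, 1, 0)) (l - (p, 1 - p, 0)) x =
      P1 \<alpha>0 (\<alpha>1 + 1) (m1 - p) * P2 (A + 1 - 2 * of_int p) (\<alpha>2 + 1) (m2 - 1 + p) * F3" for p
    proof -
      have "koornwinder (\<alpha> + (0, 1, 1, 0)) (l - (p, 1 - p, 0)) x =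
        koornwinder (\<alpha>0, \<alpha>1 + 1, \<alpha>2 + 1, \<alpha>3) (m1 - p, m2 - 1 + p, m3) x"
        by (simp add: \<alpha> l m1_def m2_def m3_def algebra_simps del: koornwinder.simps)
      then show ?thesis
        unfolding F3_def by (simp only:) (rule K; simp add: A_def B_def m1_def m2_def)
    qed
    have D: "D21 0 l \<alpha> = 2 * dcoef A \<alpha>2 m2 * b1 \<alpha>0 \<alpha>1 m1"
      "D21 1 l \<alpha> = edge_coeff ?\<kappa> (- b2 \<alpha>1 \<alpha>0 m1) A \<alpha>2 m2"
      by (simp_all add: \<alpha> l m1_def m2_def A_def Let_def edge_coeff_def)
    have "?\<kappa> * P1 \<alpha>0 (\<alpha>1 + 1) (m1 - 1) * F2 + F1 * V2 =
      2 * dcoef A \<alpha>2 m2 * b1 \<alpha>0 \<alpha>1 m1 * (P1 \<alpha>0 (\<alpha>1 + 1) m1 * P2 (A + 1) (\<alpha>2 + 1) (m2 - 1)) +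
      edge_coeff ?\<kappa> (- b2 \<alpha>1 \<alpha>0 m1) A \<alpha>2 m2 * (P1 \<alpha>0 (\<alpha>1 + 1) (m1 - 1) * P2 (A - 1) (\<alpha>2 + 1) m2)"
      unfolding F1_def F2_def V2_def P1_def P2_def \<kappa>
      by (rule edge_relation[OF split_b1(1,2)]) (use bounds in \<open>auto simp: m2_def\<close>)
    \<comment> \<open>In \<open>\<partial>\<^sub>2 - \<partial>\<^sub>1\<close> the derivative in \<open>- Y\<close> of the first factor is replaced by that in \<open>- X\<close>.\<close>
    moreover have "(U1 * F2 + F1 * V2) * F3 - (X1 + U1) * F2 * F3 =
      (?\<kappa> * P1 \<alpha>0 (\<alpha>1 + 1) (m1 - 1) * F2 + F1 * V2) * F3"
      unfolding X1 by (simp add: algebra_simps)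
    ultimately show ?thesis unfolding d1 d2 sum_01 k D by (simp add: algebra_simps)
  qed
  have E4: "partial_deriv 3 (koornwinder \<alpha> l) x =
        (\<Sum>p=0..1. \<Sum>q=0..1. D3 p q l \<alpha> * koornwinder (\<alpha> + (1, 0, 0, 1)) (l - (p, q - p, 1 - q)) x)"
  proof -
    have k: "koornwinder (\<alpha> + (1, 0, 0, 1)) (l - (p, q - p, 1 - q)) x =
      P1 (\<alpha>0 + 1) \<alpha>1 (m1 - p) * P2 (A + 1 - 2 * of_int p) \<alpha>2 (m2 - q + p)
        * P3 (B + 1 - 2 * of_int q) (\<alpha>3 + 1) (m3 - 1 + q)" for p q
    proof -
      have "koornwinder (\<alpha> + (1, 0, 0, 1)) (l - (p, q - p, 1 - q)) x =
        koornwinder (\<alpha>0 + 1, \<alpha>1, \<alpha>2, \<alpha>3 + 1) (m1 - p, m2 - q + p, m3 - 1 + q) x"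
        by (simp add: \<alpha> l m1_def m2_def m3_def algebra_simps del: koornwinder.simps)
      then show ?thesis
        by (simp only:) (rule K; simp add: A_def B_def m1_def m2_def)
    qed
    have D: "D3 0 0 l \<alpha> = 2 * dcoef B \<alpha>3 m3 * b1 \<alpha>0 \<alpha>1 m1 * b1 A \<alpha>2 m2"
      "D3 0 1 l \<alpha> = b1 \<alpha>0 \<alpha>1 m1 * edge_coeff ?\<theta> (b2 A \<alpha>2 m2) B \<alpha>3 m3"
      "D3 1 0 l \<alpha> = 2 * dcoef B \<alpha>3 m3 * b2 \<alpha>0 \<alpha>1 m1 * e2 (A - 1) \<alpha>2 m2"
      "D3 1 1 l \<alpha> = face_coeff ?\<rho> (b2 \<alpha>0 \<alpha>1 m1) ?\<theta> A \<alpha>2 m2 B \<alpha>3 m3"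
      by (simp_all add: \<alpha> l m1_def m2_def m3_def A_def B_def Let_def edge_coeff_def face_coeff_def
        algebra_simps)
    note face = face_relation[OF split_a1(1,2) AB(1) bounds(3,4) AB(2) Y(2), of l3 "x $ 3",
      folded m2_def m3_def, folded \<theta> \<rho>, unfolded P]
    have "partial_deriv 3 (koornwinder \<alpha> l) x =
      ?\<rho> * P1 (\<alpha>0 + 1) \<alpha>1 (m1 - 1) * P2 A \<alpha>2 m2 * P3 B \<alpha>3 m3 +
      P1 \<alpha>0 \<alpha>1 m1 * (lowering_weight A \<alpha>2 m2 * P2 (A + 1) \<alpha>2 (m2 - 1) * P3 B \<alpha>3 m3 +
        P2 A \<alpha>2 m2 * (2 * dcoef B \<alpha>3 m3 * P3 (B + 1) (\<alpha>3 + 1) (m3 - 1)))"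
      unfolding d3 U1 U2_def V3_def F1_def F2_def F3_def ..
    then show ?thesis
      unfolding face sum_01 k D by (simp add: algebra_simps)
  qed
  have E5: "partial_deriv 1 (koornwinder \<alpha> l) x - partial_deriv 3 (koornwinder \<alpha> l) x =
        (\<Sum>p=0..1. \<Sum>q=0..1. D13 p q l \<alpha> * koornwinder (\<alpha> + (0, 1, 0, 1)) (l - (p, q - p, 1 - q)) x)"
  proof -
    have k: "koornwinder (\<alpha> + (0, 1, 0, 1)) (l - (p, q - p, 1 - q)) x =
      P1 \<alpha>0 (\<alpha>1 + 1) (m1 - p) * P2 (A + 1 - 2 * of_int p) \<alpha>2 (m2 - q + p)
        * P3 (B + 1 - 2 * of_int q) (\<alpha>3 + 1) (m3 - 1 + q)" for p q
    proof -
      have "koornwinder (\<alpha> + (0, 1, 0, 1)) (l - (p, q - p, 1 - q)) x =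
        koornwinder (\<alpha>0, \<alpha>1 + 1, \<alpha>2, \<alpha>3 + 1) (m1 - p, m2 - q + p, m3 - 1 + q) x"
        by (simp add: \<alpha> l m1_def m2_def m3_def algebra_simps del: koornwinder.simps)
      then show ?thesis
        by (simp only:) (rule K; simp add: A_def B_def m1_def m2_def)
    qed
    have D: "D13 0 0 l \<alpha> = - (2 * dcoef B \<alpha>3 m3 * b1 \<alpha>0 \<alpha>1 m1 * b1 A \<alpha>2 m2)"
      "D13 0 1 l \<alpha> = - (b1 \<alpha>0 \<alpha>1 m1 * edge_coeff ?\<theta> (b2 A \<alpha>2 m2) B \<alpha>3 m3)"
      "D13 1 0 l \<alpha> = - (2 * dcoef B \<alpha>3 m3 * (- b2 \<alpha>1 \<alpha>0 m1) * e2 (A - 1) \<alpha>2 m2)"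
      by (simp_all add: \<alpha> l m1_def m2_def m3_def A_def B_def Let_def edge_coeff_def face_coeff_def
        algebra_simps)
    \<comment> \<open>The sign is moved into the numerator because the denominator may vanish.\<close>
    have D11: "D13 1 1 l \<alpha> = - face_coeff ?\<kappa> (- b2 \<alpha>1 \<alpha>0 m1) ?\<theta> A \<alpha>2 m2 B \<alpha>3 m3"
      unfolding face_coeff_def minus_divide_left
      by (simp add: \<alpha> l m1_def m2_def m3_def A_def B_def Let_def algebra_simps)
    note face = face_relation[OF split_b1(1,2) AB(1) bounds(3,4) AB(2) Y(2), of l3 "x $ 3",
      folded m2_def m3_def, folded \<theta> \<kappa>, unfolded P]
    have "partial_deriv 1 (koornwinder \<alpha> l) x - partial_deriv 3 (koornwinder \<alpha> l) x =
      - (?\<kappa> * P1 \<alpha>0 (\<alpha>1 + 1) (m1 - 1) * P2 A \<alpha>2 m2 * P3 B \<alpha>3 m3 +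
      P1 \<alpha>0 \<alpha>1 m1 * (lowering_weight A \<alpha>2 m2 * P2 (A + 1) \<alpha>2 (m2 - 1) * P3 B \<alpha>3 m3 +
        P2 A \<alpha>2 m2 * (2 * dcoef B \<alpha>3 m3 * P3 (B + 1) (\<alpha>3 + 1) (m3 - 1))))"
      unfolding d1 d3 X1 U2_def V3_def F1_def F2_def F3_def by (simp add: algebra_simps)
    then show ?thesis
      unfolding face sum_01 k D D11 by (simp add: algebra_simps)
  qed
  have E6: "partial_deriv 3 (koornwinder \<alpha> l) x - partial_deriv 2 (koornwinder \<alpha> l) x =
        (\<Sum>q=0..1. D32 q l \<alpha> * koornwinder (\<alpha> + (0, 0, 1, 1)) (l - (0, q, 1 - q)) x)"
  proof -
    have k: "koornwinder (\<alpha> + (0, 0, 1, 1)) (l - (0, q, 1 - q)) x =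
      F1 * P2 A (\<alpha>2 + 1) (m2 - q) * P3 (B + 1 - 2 * of_int q) (\<alpha>3 + 1) (m3 - 1 + q)" for q
    proof -
      have "koornwinder (\<alpha> + (0, 0, 1, 1)) (l - (0, q, 1 - q)) x =
        koornwinder (\<alpha>0, \<alpha>1, \<alpha>2 + 1, \<alpha>3 + 1) (m1, m2 - q, m3 - 1 + q) x"
        by (simp add: \<alpha> l m1_def m2_def m3_def algebra_simps del: koornwinder.simps)
      then show ?thesis
        unfolding F1_def by (simp only:) (rule K; simp add: A_def B_def m1_def m2_def)
    qed
    have D: "D32 0 l \<alpha> = 2 * dcoef B \<alpha>3 m3 * b1 A \<alpha>2 m2"
      "D32 1 l \<alpha> = edge_coeff ?\<kappa>2 (- b2 \<alpha>2 A m2) B \<alpha>3 m3"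
      by (simp_all add: \<alpha> l m1_def m2_def m3_def A_def B_def Let_def edge_coeff_def)
    have "?\<kappa>2 * P2 A (\<alpha>2 + 1) (m2 - 1) * F3 + F2 * V3 =
      2 * dcoef B \<alpha>3 m3 * b1 A \<alpha>2 m2 * (P2 A (\<alpha>2 + 1) m2 * P3 (B + 1) (\<alpha>3 + 1) (m3 - 1)) +
      edge_coeff ?\<kappa>2 (- b2 \<alpha>2 A m2) B \<alpha>3 m3 * (P2 A (\<alpha>2 + 1) (m2 - 1) * P3 (B - 1) (\<alpha>3 + 1) m3)"
      unfolding F2_def F3_def V3_def P2_def P3_def
      by (rule edge_relation[OF split_b2(1)]) (use bounds split_b2(2) in \<open>auto simp: m2_def m3_def\<close>)
    \<comment> \<open>The first factor is constant along this edge, which leaves the product of the last two.\<close>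
    moreover have "U1 * F2 * F3 + F1 * (U2 * F3 + F2 * V3) - (U1 * F2 + F1 * V2) * F3 =
       F1 * (?\<kappa>2 * P2 A (\<alpha>2 + 1) (m2 - 1) * F3 + F2 * V3)"
      unfolding V2[symmetric] X2 by (simp add: algebra_simps)
    ultimately show ?thesis unfolding d2 d3 sum_01 k D by (simp add: algebra_simps)
  qed
  from E1 E2 E3 E4 E5 E6 show ?thesis by blast
qed

end
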